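(* Let $n\ge2$ and let $u,v$ be Hadamard unitaries in $\mathbb{M}_n$ with $u\not\sim v$ and $\mathrm{d}_{\mathrm{KK}}(\mathscr{R}_u,\mathscr{R}_v)\neq 1$. Then either $\mathscr{R}_u\cap\mathscr{R}_v$ is not a finite-index subfactor of $\mathscr{R}$, or the quadruple $(\mathscr{R},\mathscr{R}_u,\mathscr{R}_v,\mathscr{R}_u\cap\mathscr{R}_v)$ does not form a commuting square.
   Context: $\mathbb{M}_n$ is the algebra of $n\times n$ complex matrices with matrix units $E_{ij}$ and identity $\mathbb{I}_n$, and $\Delta\subset \mathbb{M}_n$ is the algebra of diagonal matrices. A Hadamard unitary in $\mathbb{M}_n$ is a unitary matrix all of whose entries have modulus $n^{-1/2}$. Ambient factor: $\mathscr{R}$ is the hyperfinite $\mathrm{II}_1$-factor obtained as the weak closure, in the GNS representation of the unique normalized trace $\tau$, of $\bigcup_k \mathbb{M}_n^{\otimes k}$, where $\mathbb{M}_n^{\otimes k}\subset\mathbb{M}_n^{\otimes(k+1)}$ via $x\mapsto x\otimes \mathbb{I}_n$. Spin model subfactor: for a Hadamard unitary $u=(u_{ij})\in\mathbb{M}_n$ put $D_u:=\sqrt n\sum_{i,j}\overline{u_{ij}}\,(E_{jj}\otimes E_{ii})$, $u_1:=(u\otimes \mathbb{I}_n)D_u\in\mathbb{M}_n\otimes\Delta$, and for $k\ge1$, $u_{2k-1}:=\prod_{i=0}^{k-1}\big(\mathbb{I}_n^{\otimes i}\otimes u_1\otimes \mathbb{I}_n^{\otimes (k-1-i)}\big)\in\mathbb{M}_n^{\otimes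 (k+1)}$ (factors ordered from left to right with increasing $i$). The algebras $u_{2k-1}(\mathbb{M}_n^{\otimes k}\otimes \mathbb{I}_n)u_{2k-1}^*$ increase with $k$, and $\mathscr{R}_u\subset\mathscr{R}$ is the weak closure of their union. Bakshi–Guin equivalence: $u\sim v$ means there exist a permutation matrix $P$ and a diagonal unitary matrix $D$ with $v=uPD$. Commuting square: $(M,P,Q,N)$ with $N\subset P,Q\subset M$ and $\tau$-preserving conditional expectations $E_N,E_P,E_Q$ from $M$ is a commuting square if $E_PE_Q=E_N=E_QE_P$. Kadison–Kastler distance: $\mathrm{d}_{\mathrm{KK}}(P,Q)$ is the Hausdorff distance, in operator norm, between the operator-norm closed unit balls of $P$ and $Q$. *)

theory Defs
  imports "HOL-Analysis.Analysis"
begin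

section \<open>Complex inner product spaces and their Hilbert completion\<close>

class complex_vector = real_vector +
  fixes scaleC :: "complex \<Rightarrow> 'a \<Rightarrow> 'a" (infixr \<open>*\<^sub>C\<close> 75)
  assumes scaleC_add_right: "c *\<^sub>C (x + y) = c *\<^sub>C x + c *\<^sub>C y"
    and scaleC_add_left: "(b + c) *\<^sub>C x = b *\<^sub>C x + c *\<^sub>C x"
    and scaleC_scaleC: "b *\<^sub>C c *\<^sub>C x = (b * c) *\<^sub>C x"
    and scaleC_of_real: "of_real r *\<^sub>C x = r *\<^sub>R x"

text \<open>The inner product is linear in the first variable; its real part is the real inner
  product of the library, so that both induce the same norm.\<close>

class complex_inner = complex_vector + real_inner +
  fixes cinner :: "'a \<Rightarrow> 'a \<Rightarrow> complex"
  assumes cinner_add_left: "cinner (x + y) z = cinner x z + cinner y z"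
    and cinner_scaleC_left: "cinner (c *\<^sub>C x) y = c * cinner x y"
    and cinner_commute: "cinner x y = cnj (cinner y x)"
    and Re_cinner: "Re (cinner x y) = inner x y"

class complex_hilbert = complex_inner + complete_space

lemma cinner_add_right: "cinner x (y + z) = cinner x y + cinner x z"
  by (metis cinner_add_left cinner_commute complex_cnj_add)

lemma cinner_scaleC_right: "cinner x (c *\<^sub>C y) = cnj c * cinner x y"
  by (metis cinner_scaleC_left cinner_commute complex_cnj_mult)

lemma cinner_scaleR_left: "cinner (r *\<^sub>R x) y = of_real r * cinner x y"
  by (metis cinner_scaleC_left scaleC_of_real)

lemma cinner_scaleR_right: "cinner x (r *\<^sub>R y) = of_real r * cinner x y"
  by (metis cinner_scaleC_right scaleC_of_real complex_cnj_complex_of_real)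

lemma cinner_self: "cinner x x = of_real ((norm x)\<^sup>2)"
proof -
  have "Im (cinner x x) = - Im (cinner x x)"
    using arg_cong [OF cinner_commute [of x x], of Im] by simp
  then show ?thesis
    by (simp add: complex_eq_iff Re_cinner power2_norm_eq_inner)
qed

lemma norm_scaleC: "norm (c *\<^sub>C x) = cmod c * norm (x::'a::complex_inner)"
proof -
  have "complex_of_real ((norm (c *\<^sub>C x))\<^sup>2) = c * cnj c * of_real ((norm x)\<^sup>2)"
    by (simp only: cinner_self [symmetric] cinner_scaleC_left cinner_scaleC_right mult_ac)
  also have "\<dots> = of_real ((cmod c * norm x)\<^sup>2)"
    by (simp only: complex_norm_square [symmetric] of_real_mult [symmetric] power_mult_distrib)
  finally have "(norm (c *\<^sub>C x))\<^sup>2 = (cmod c * norm x)\<^sup>2"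
    using of_real_eq_iff by blast
  then show ?thesis by (simp add: power2_eq_iff_nonneg)
qed

lemma norm_cinner_le: "cmod (cinner x y) \<le> norm x * norm y"
proof (cases "cinner x y = 0")
  case False
  define c where "c = cnj (sgn (cinner x y))"
  have c: "cmod c = 1" using False by (simp add: c_def norm_sgn)
  have eq: "c * cinner x y = of_real (cmod (cinner x y))"
    using False
    by (simp add: c_def sgn_div_norm scaleR_conv_of_real field_simps
        complex_norm_square [symmetric] power2_eq_square)
  have "cmod (cinner x y) = Re (cinner (c *\<^sub>C x) y)"
    by (simp add: cinner_scaleC_left eq)
  also have "\<dots> = inner (c *\<^sub>C x) y" by (rule Re_cinner)
  also have "\<dots> \<le> norm (c *\<^sub>C x) * norm y" by (rule norm_cauchy_schwarz)
  finally show ?thesis by (simp add: norm_scaleC c)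
qed simp

text \<open>The completion is realised as a closure in a Banach space of functionals: \<open>riesz\<close> is a
  complex-linear isometry, and closed subspaces of Banach spaces are complete.\<close>

lift_definition riesz :: "'a::complex_inner \<Rightarrow> ('a \<Rightarrow>\<^sub>L complex)" is "\<lambda>x y. cinner x y"
proof -
  fix x :: 'a
  show "bounded_linear (cinner x)"
    by (rule bounded_linear_intro [where K = "norm x"])
      (auto simp: cinner_add_right cinner_scaleR_right scaleR_conv_of_real
        norm_cinner_le mult.commute [of "norm _" "norm x"])
qed

lift_definition blinfun_cmult :: "complex \<Rightarrow> ('a::real_normed_vector \<Rightarrow>\<^sub>L complex) \<Rightarrow> ('a \<Rightarrow>\<^sub>L complex)"
  is "\<lambda>c f x. c * f x"
  by (rule bounded_linear_mult_right [THEN bounded_linear_compose])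

lemma riesz_add: "riesz (x + y) = riesz x + riesz y"
  by (rule blinfun_eqI) (simp add: riesz.rep_eq blinfun.add_left cinner_add_left)

lemma riesz_scaleR: "riesz (r *\<^sub>R x) = r *\<^sub>R riesz x"
  by (rule blinfun_eqI) (simp add: riesz.rep_eq blinfun.scaleR_left cinner_scaleR_left scaleR_conv_of_real)

lemma riesz_scaleC: "riesz (c *\<^sub>C x) = blinfun_cmult c (riesz x)"
  by (rule blinfun_eqI) (simp add: riesz.rep_eq blinfun_cmult.rep_eq cinner_scaleC_left)

lemma riesz_diff: "riesz (x - y) = riesz x - riesz y"
  using riesz_add [of "x - y" y] by (simp add: algebra_simps)

lemma norm_riesz: "norm (riesz x) = norm x"
proof (rule antisym)
  show "norm (riesz x) \<le> norm x"
    by (rule norm_blinfun_bound) (auto simp: riesz.rep_eq norm_cinner_le)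
  show "norm x \<le> norm (riesz x)"
  proof (cases "x = 0")
    case False
    have "norm x * norm x = norm (riesz x x)"
      by (simp add: riesz.rep_eq cinner_self power2_eq_square norm_mult)
    also have "\<dots> \<le> norm (riesz x) * norm x" by (rule norm_blinfun)
    finally show ?thesis using False by simp
  qed simp
qed

lemma bounded_linear_blinfun_cmult: "bounded_linear (blinfun_cmult c)"
proof (rule bounded_linear_intro [where K = "cmod c"])
  fix f g :: "'a \<Rightarrow>\<^sub>L complex" and r :: real
  show "blinfun_cmult c (f + g) = blinfun_cmult c f + blinfun_cmult c g"
    by (rule blinfun_eqI) (simp add: blinfun_cmult.rep_eq blinfun.add_left algebra_simps)
  show "blinfun_cmult c (r *\<^sub>R f) = r *\<^sub>R blinfun_cmult c f"
    by (rule blinfun_eqI) (simp add: blinfun_cmult.rep_eq blinfun.scaleR_left)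
  show "norm (blinfun_cmult c f) \<le> norm f * cmod c"
  proof (rule norm_blinfun_bound)
    fix x
    have "cmod c * norm (f x) \<le> cmod c * (norm f * norm x)"
      by (rule mult_left_mono [OF norm_blinfun]) simp
    then show "norm (blinfun_cmult c f x) \<le> norm f * cmod c * norm x"
      by (simp add: blinfun_cmult.rep_eq norm_mult mult_ac)
  qed simp
qed

lemma subspace_range_riesz: "subspace (range riesz)"
  unfolding subspace_def
  by (metis (no_types, lifting) rangeE rangeI riesz_add riesz_scaleR scaleR_zero_left)

lemma subspace_closure_riesz: "subspace (closure (range (riesz :: 'a::complex_inner \<Rightarrow> _)))"
proof -
  let ?S = "range (riesz :: 'a \<Rightarrow> _)"
  show ?thesis
    unfolding subspace_def
  proof (intro conjI ballI allI)
    show "0 \<in> closure ?S"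
      by (rule subsetD [OF closure_subset subspace_0 [OF subspace_range_riesz]])
  next
    fix f g assume "f \<in> closure ?S" "g \<in> closure ?S"
    then obtain X Y where X: "\<forall>n. X n \<in> ?S" "X \<longlonglongrightarrow> f" and Y: "\<forall>n. Y n \<in> ?S" "Y \<longlonglongrightarrow> g"
      by (auto simp: closure_sequential)
    have "\<forall>n. X n + Y n \<in> ?S"
      using X(1) Y(1) subspace_add [OF subspace_range_riesz] by metis
    moreover have "(\<lambda>n. X n + Y n) \<longlonglongrightarrow> f + g"
      by (rule tendsto_add [OF X(2) Y(2)])
    ultimately show "f + g \<in> closure ?S"
      by (subst closure_sequential) (rule exI [of _ "\<lambda>n. X n + Y n"], rule conjI)
  next
    fix r :: real and f assume "f \<in> closure ?S"
    then obtain X where X: "\<forall>n. X n \<in> ?S" "X \<longlonglongrightarrow> f"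
      by (auto simp: closure_sequential)
    have "\<forall>n. r *\<^sub>R X n \<in> ?S"
      using X(1) subspace_scale [OF subspace_range_riesz] by metis
    moreover have "(\<lambda>n. r *\<^sub>R X n) \<longlonglongrightarrow> r *\<^sub>R f"
      by (rule tendsto_scaleR [OF tendsto_const X(2)])
    ultimately show "r *\<^sub>R f \<in> closure ?S"
      by (subst closure_sequential) (rule exI [of _ "\<lambda>n. r *\<^sub>R X n"], rule conjI)
  qed
qed

lemma closure_riesz_cmult:
  assumes "f \<in> closure (range riesz)"
  shows "blinfun_cmult c f \<in> closure (range riesz)"
proof -
  have "blinfun_cmult c ` closure (range riesz) \<subseteq> closure (blinfun_cmult c ` range riesz)"
    by (rule closure_bounded_linear_image_subset [OF bounded_linear_blinfun_cmult])
  also have "\<dots> \<subseteq> closure (range riesz)"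
    by (rule closure_mono) (auto simp: riesz_scaleC [symmetric])
  finally show ?thesis using assms by blast
qed

definition polar :: "('a::complex_inner \<Rightarrow>\<^sub>L complex) \<Rightarrow> ('a \<Rightarrow>\<^sub>L complex) \<Rightarrow> complex" where
  "polar f g = (of_real ((norm (f + g))\<^sup>2) - of_real ((norm (f - g))\<^sup>2)
     + \<i> * of_real ((norm (f + blinfun_cmult \<i> g))\<^sup>2)
     - \<i> * of_real ((norm (f - blinfun_cmult \<i> g))\<^sup>2)) / 4"

lemma polar_riesz: "polar (riesz x) (riesz y) = cinner x y"
proof -
  have *: "inner x (\<i> *\<^sub>C y) = Im (cinner x y)" for x y :: 'a
    by (simp add: Re_cinner [symmetric] cinner_scaleC_right)
  have p: "(norm (x + z))\<^sup>2 - (norm (x - z))\<^sup>2 = 4 * inner x z" for x z :: 'a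
    by (simp add: power2_norm_eq_inner inner_add_left inner_add_right inner_diff_left
        inner_diff_right inner_commute)
  have "polar (riesz x) (riesz y) =
      (of_real ((norm (x + y))\<^sup>2 - (norm (x - y))\<^sup>2)
       + \<i> * of_real ((norm (x + \<i> *\<^sub>C y))\<^sup>2 - (norm (x - \<i> *\<^sub>C y))\<^sup>2)) / 4"
    unfolding polar_def riesz_add [symmetric] riesz_diff [symmetric] riesz_scaleC [symmetric]
      norm_riesz of_real_diff right_diff_distrib by simp
  also have "\<dots> = cinner x y"
    unfolding p * by (simp add: complex_eq_iff Re_cinner)
  finally show ?thesis .
qed

lemma tendsto_blinfun_cmult:
  "(f \<longlongrightarrow> a) F \<Longrightarrow> ((\<lambda>n. blinfun_cmult c (f n)) \<longlongrightarrow> blinfun_cmult c a) F"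
  by (rule bounded_linear.tendsto [OF bounded_linear_blinfun_cmult])

lemma tendsto_polar:
  assumes f: "(f \<longlongrightarrow> a) F" and g: "(g \<longlongrightarrow> b) F"
  shows "((\<lambda>n. polar (f n) (g n)) \<longlongrightarrow> polar a b) F"
proof -
  have nrm: "((\<lambda>n. complex_of_real ((norm (h n))\<^sup>2)) \<longlongrightarrow> of_real ((norm c)\<^sup>2)) F"
    if "(h \<longlongrightarrow> c) F" for h :: "_ \<Rightarrow> 'b \<Rightarrow>\<^sub>L complex" and c
    by (rule tendsto_of_real, rule tendsto_power, rule tendsto_norm, rule that)
  note ig = tendsto_blinfun_cmult [OF g, of \<i>]
  note t1 = nrm [OF tendsto_add [OF f g]] and t2 = nrm [OF tendsto_diff [OF f g]]
    and t3 = tendsto_mult_left [OF nrm [OF tendsto_add [OF f ig]], of \<i>]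
    and t4 = tendsto_mult_left [OF nrm [OF tendsto_diff [OF f ig]], of \<i>]
  show ?thesis
    unfolding polar_def
    by (rule tendsto_divide [OF tendsto_diff [OF tendsto_add [OF tendsto_diff [OF t1 t2] t3] t4]
          tendsto_const]) simp
qed

typedef (overloaded) 'a hcompletion = "closure (range (riesz :: 'a::complex_inner \<Rightarrow> _))"
  morphisms functional_of Abs_hcompletion
  by (rule exI [of _ "riesz 0"]) (rule subsetD [OF closure_subset rangeI])

setup_lifting type_definition_hcompletion

lift_definition embed :: "'a::complex_inner \<Rightarrow> 'a hcompletion" is riesz
  by (rule subsetD [OF closure_subset rangeI])

lemma riesz_approx:
  fixes x :: "'a::complex_inner hcompletion"
  obtains X where "(\<lambda>n. riesz (X n)) \<longlonglongrightarrow> functional_of x"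
proof -
  have "functional_of x \<in> closure (range riesz)" by (rule functional_of)
  then obtain Y where Y: "\<forall>n. Y n \<in> range (riesz :: 'a \<Rightarrow> _)" "Y \<longlonglongrightarrow> functional_of x"
    by (auto simp: closure_sequential)
  have "\<forall>n. \<exists>z. Y n = riesz z" using Y(1) by (simp add: image_iff)
  then obtain X where "\<forall>n. Y n = riesz (X n)" by (rule choice [THEN exE])
  then have "Y = (\<lambda>n. riesz (X n))" by (intro ext) simp
  with Y(2) show ?thesis by (intro that) simp
qed

instantiation hcompletion :: (complex_inner) complex_inner
begin

lift_definition zero_hcompletion :: "'a hcompletion" is 0
  by (rule subspace_0 [OF subspace_closure_riesz])
lift_definition plus_hcompletion :: "'a hcompletion \<Rightarrow> 'a hcompletion \<Rightarrow> 'a hcompletion" is "(+)"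
  by (rule subspace_add [OF subspace_closure_riesz])
lift_definition uminus_hcompletion :: "'a hcompletion \<Rightarrow> 'a hcompletion" is uminus
  by (rule subspace_neg [OF subspace_closure_riesz])
lift_definition minus_hcompletion :: "'a hcompletion \<Rightarrow> 'a hcompletion \<Rightarrow> 'a hcompletion" is "(-)"
  by (rule subspace_diff [OF subspace_closure_riesz])
lift_definition scaleR_hcompletion :: "real \<Rightarrow> 'a hcompletion \<Rightarrow> 'a hcompletion" is scaleR
  by (rule subspace_scale [OF subspace_closure_riesz])
lift_definition scaleC_hcompletion :: "complex \<Rightarrow> 'a hcompletion \<Rightarrow> 'a hcompletion" is blinfun_cmult
  by (rule closure_riesz_cmult)
lift_definition norm_hcompletion :: "'a hcompletion \<Rightarrow> real" is norm .
lift_definition cinner_hcompletion :: "'a hcompletion \<Rightarrow> 'a hcompletion \<Rightarrow> complex" is polar .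

definition inner_hcompletion :: "'a hcompletion \<Rightarrow> 'a hcompletion \<Rightarrow> real" where
  "inner_hcompletion x y = Re (cinner x y)"
definition sgn_hcompletion :: "'a hcompletion \<Rightarrow> 'a hcompletion" where
  "sgn_hcompletion x = inverse (norm x) *\<^sub>R x"
definition dist_hcompletion :: "'a hcompletion \<Rightarrow> 'a hcompletion \<Rightarrow> real" where
  "dist_hcompletion x y = norm (x - y)"
definition uniformity_hcompletion :: "('a hcompletion \<times> 'a hcompletion) filter" where
  "uniformity_hcompletion = (INF e\<in>{0<..}. principal {(x, y). dist x y < e})"
definition open_hcompletion :: "'a hcompletion set \<Rightarrow> bool" where
  "open_hcompletion U = (\<forall>x\<in>U. eventually (\<lambda>(x', y). x' = x \<longrightarrow> y \<in> U) uniformity)"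

instance
proof
  fix x y z :: "'a hcompletion" and b c :: complex and r s :: real
  show "x + y + z = x + (y + z)" "x + y = y + x" "0 + x = x" "- x + x = 0" "x - y = x + - y"
    by (transfer; simp)+
  show "r *\<^sub>R (x + y) = r *\<^sub>R x + r *\<^sub>R y" "(r + s) *\<^sub>R x = r *\<^sub>R x + s *\<^sub>R x"
    "r *\<^sub>R s *\<^sub>R x = (r * s) *\<^sub>R x" "1 *\<^sub>R x = x"
    by (transfer; simp add: algebra_simps)+
  show "c *\<^sub>C (x + y) = c *\<^sub>C x + c *\<^sub>C y" "(b + c) *\<^sub>C x = b *\<^sub>C x + c *\<^sub>C x"
    "b *\<^sub>C c *\<^sub>C x = (b * c) *\<^sub>C x" "of_real r *\<^sub>C x = r *\<^sub>R x"
    by (transfer; intro blinfun_eqI;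
        simp add: blinfun_cmult.rep_eq blinfun.add_left blinfun.scaleR_left algebra_simps
          scaleR_conv_of_real)+
  show "sgn x = inverse (norm x) *\<^sub>R x" by (rule sgn_hcompletion_def)
  show "dist x y = norm (x - y)" by (rule dist_hcompletion_def)
  show "uniformity = (INF e\<in>{0<..}. principal {(x :: 'a hcompletion, y). dist x y < e})"
    by (rule uniformity_hcompletion_def)
  show "open U = (\<forall>x\<in>U. eventually (\<lambda>(x', y). x' = x \<longrightarrow> y \<in> U) uniformity)"
    for U :: "'a hcompletion set"
    by (rule open_hcompletion_def)
  obtain X where X: "(\<lambda>n. riesz (X n)) \<longlonglongrightarrow> functional_of x" by (rule riesz_approx)
  obtain Y where Y: "(\<lambda>n. riesz (Y n)) \<longlonglongrightarrow> functional_of y" by (rule riesz_approx)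
  obtain Z where Z: "(\<lambda>n. riesz (Z n)) \<longlonglongrightarrow> functional_of z" by (rule riesz_approx)
  show add: "cinner (x + y) z = cinner x z + cinner y z" for x y z :: "'a hcompletion"
  proof -
    obtain X where X: "(\<lambda>n. riesz (X n)) \<longlonglongrightarrow> functional_of x" by (rule riesz_approx)
    obtain Y where Y: "(\<lambda>n. riesz (Y n)) \<longlonglongrightarrow> functional_of y" by (rule riesz_approx)
    obtain Z where Z: "(\<lambda>n. riesz (Z n)) \<longlonglongrightarrow> functional_of z" by (rule riesz_approx)
    have 1: "(\<lambda>n. polar (riesz (X n) + riesz (Y n)) (riesz (Z n))) \<longlonglongrightarrow> cinner (x + y) z"
      unfolding cinner_hcompletion.rep_eq plus_hcompletion.rep_eq by (intro tendsto_polar tendsto_add X Y Z)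
    have 2: "(\<lambda>n. polar (riesz (X n)) (riesz (Z n)) + polar (riesz (Y n)) (riesz (Z n)))
        \<longlonglongrightarrow> cinner x z + cinner y z"
      unfolding cinner_hcompletion.rep_eq by (intro tendsto_polar tendsto_add X Y Z)
    have "polar (riesz (X n) + riesz (Y n)) (riesz (Z n)) =
        polar (riesz (X n)) (riesz (Z n)) + polar (riesz (Y n)) (riesz (Z n))" for n
      by (simp only: riesz_add [symmetric] polar_riesz cinner_add_left)
    with 1 2 show ?thesis using LIMSEQ_unique by fastforce
  qed
  show scC: "cinner (c *\<^sub>C x) y = c * cinner x y" for c and x y :: "'a hcompletion"
  proof -
    obtain X where X: "(\<lambda>n. riesz (X n)) \<longlonglongrightarrow> functional_of x" by (rule riesz_approx)
    obtain Y where Y: "(\<lambda>n. riesz (Y n)) \<longlonglongrightarrow> functional_of y" by (rule riesz_approx)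
    have 1: "(\<lambda>n. polar (blinfun_cmult c (riesz (X n))) (riesz (Y n))) \<longlonglongrightarrow> cinner (c *\<^sub>C x) y"
      unfolding cinner_hcompletion.rep_eq scaleC_hcompletion.rep_eq
      by (intro tendsto_polar tendsto_blinfun_cmult X Y)
    have 2: "(\<lambda>n. c * polar (riesz (X n)) (riesz (Y n))) \<longlonglongrightarrow> c * cinner x y"
      unfolding cinner_hcompletion.rep_eq by (intro tendsto_polar tendsto_mult_left tendsto_cnj X Y)
    have "polar (blinfun_cmult c (riesz (X n))) (riesz (Y n)) =
        c * polar (riesz (X n)) (riesz (Y n))" for n
      by (simp only: riesz_scaleC [symmetric] polar_riesz cinner_scaleC_left)
    with 1 2 show ?thesis using LIMSEQ_unique by fastforce
  qed
  show comm: "cinner x y = cnj (cinner y x)" for x y :: "'a hcompletion"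
  proof -
    obtain X where X: "(\<lambda>n. riesz (X n)) \<longlonglongrightarrow> functional_of x" by (rule riesz_approx)
    obtain Y where Y: "(\<lambda>n. riesz (Y n)) \<longlonglongrightarrow> functional_of y" by (rule riesz_approx)
    have 1: "(\<lambda>n. polar (riesz (X n)) (riesz (Y n))) \<longlonglongrightarrow> cinner x y"
      unfolding cinner_hcompletion.rep_eq by (intro tendsto_polar tendsto_mult_left tendsto_cnj X Y)
    have 2: "(\<lambda>n. cnj (polar (riesz (Y n)) (riesz (X n)))) \<longlonglongrightarrow> cnj (cinner y x)"
      unfolding cinner_hcompletion.rep_eq by (intro tendsto_polar tendsto_mult_left tendsto_cnj X Y)
    have "polar (riesz (X n)) (riesz (Y n)) = cnj (polar (riesz (Y n)) (riesz (X n)))" for n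
      using polar_riesz cinner_commute by metis
    with 1 2 show ?thesis using LIMSEQ_unique by fastforce
  qed
  show "Re (cinner x y) = inner x y" by (simp add: inner_hcompletion_def)
  have nrm: "cinner x x = of_real ((norm x)\<^sup>2)" for x :: "'a hcompletion"
  proof -
    obtain X where X: "(\<lambda>n. riesz (X n)) \<longlonglongrightarrow> functional_of x" by (rule riesz_approx)
    have 1: "(\<lambda>n. polar (riesz (X n)) (riesz (X n))) \<longlonglongrightarrow> cinner x x"
      unfolding cinner_hcompletion.rep_eq by (intro tendsto_polar X)
    have 2: "(\<lambda>n. complex_of_real ((norm (riesz (X n)))\<^sup>2)) \<longlonglongrightarrow> of_real ((norm x)\<^sup>2)"
      unfolding norm_hcompletion.rep_eq
      by (intro tendsto_of_real tendsto_power tendsto_norm X)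
    have "polar (riesz (X n)) (riesz (X n)) = complex_of_real ((norm (riesz (X n)))\<^sup>2)" for n
      by (simp only: polar_riesz cinner_self norm_riesz)
    with 1 2 show ?thesis using LIMSEQ_unique by fastforce
  qed
  show "inner x y = inner y x"
    unfolding inner_hcompletion_def by (subst comm) simp
  show "inner (x + y) z = inner x z + inner y z"
    by (simp add: inner_hcompletion_def add)
  have "r *\<^sub>R x = complex_of_real r *\<^sub>C x"
    by (transfer; intro blinfun_eqI;
        simp add: blinfun_cmult.rep_eq blinfun.scaleR_left scaleR_conv_of_real)
  then show "inner (r *\<^sub>R x) y = r * inner x y"
    by (simp add: inner_hcompletion_def scC)
  show "0 \<le> inner x x"
    by (simp add: inner_hcompletion_def nrm)
  have "norm x = 0 \<longleftrightarrow> x = 0" by transfer simp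
  then show "inner x x = 0 \<longleftrightarrow> x = 0"
    by (simp add: inner_hcompletion_def nrm)
  have "0 \<le> norm x" by transfer simp
  then show "norm x = sqrt (inner x x)"
    by (simp add: inner_hcompletion_def nrm)
qed

end

instance hcompletion :: (complex_inner) complex_hilbert
proof
  fix X :: "nat \<Rightarrow> 'a hcompletion"
  assume "Cauchy X"
  have d: "dist x y = dist (functional_of x) (functional_of y)" for x y :: "'a hcompletion"
    by (simp add: dist_norm norm_hcompletion.rep_eq minus_hcompletion.rep_eq)
  have "Cauchy (\<lambda>n. functional_of (X n))"
    using \<open>Cauchy X\<close> by (simp add: Cauchy_def d)
  then obtain f where f: "(\<lambda>n. functional_of (X n)) \<longlonglongrightarrow> f"
    using Cauchy_convergent convergent_def by blast
  have "f \<in> closure (range riesz)"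
    using closed_sequentially [OF closed_closure _ f] functional_of by blast
  then obtain x where "f = functional_of x"
    by (metis Abs_hcompletion_inverse)
  with f have "X \<longlonglongrightarrow> x"
    by (simp add: tendsto_iff d)
  then show "convergent X" by (auto simp: convergent_def)
qed

lemma cinner_embed: "cinner (embed x) (embed y) = cinner x y"
  by (simp add: cinner_hcompletion.rep_eq embed.rep_eq polar_riesz)

lemma closure_range_embed: "closure (range embed) = (UNIV :: 'a::complex_inner hcompletion set)"
proof -
  have "x \<in> closure (range embed)" for x :: "'a hcompletion"
  proof -
    obtain X where X: "(\<lambda>n. riesz (X n)) \<longlonglongrightarrow> functional_of x" by (rule riesz_approx)
    have "(\<lambda>n. embed (X n)) \<longlonglongrightarrow> x"
      using X by (simp add: tendsto_iff dist_norm norm_hcompletion.rep_eq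
          minus_hcompletion.rep_eq embed.rep_eq)
    then show ?thesis
      by (subst closure_sequential) (rule exI [of _ "\<lambda>n. embed (X n)"], simp)
  qed
  then show ?thesis by blast
qed

section \<open>The infinite tensor power of a matrix algebra\<close>

text \<open>The \<open>k\<close>-fold tensor power of the \<open>n\<times>n\<close> matrices is identified with the kernels
  \<open>x s t\<close>, indexed by pairs of sequences over the index set of the matrices, that depend only on
  the first \<open>k\<close> letters of \<open>s\<close> and \<open>t\<close> and vanish unless \<open>s\<close> and \<open>t\<close> agree from position \<open>k\<close> on.
  Thus \<open>x\<close> stands for \<open>x \<otimes> 1 \<otimes> 1 \<otimes> \<dots>\<close>, and the embeddings \<open>x \<mapsto> x \<otimes> 1\<close> become inclusions.\<close>

definition tail_class :: "nat \<Rightarrow> (nat \<Rightarrow> 'n) \<Rightarrow> (nat \<Rightarrow> 'n) set" where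
  "tail_class k s = {r. \<forall>j\<ge>k. r j = s j}"

definition kernels :: "nat \<Rightarrow> ((nat \<Rightarrow> 'n::finite) \<Rightarrow> (nat \<Rightarrow> 'n) \<Rightarrow> complex) set" where
  "kernels k = {x. (\<forall>s t. t \<notin> tail_class k s \<longrightarrow> x s t = 0) \<and>
     (\<forall>s t s' t'. t \<in> tail_class k s \<and> t' \<in> tail_class k s' \<and>
        (\<forall>j<k. s' j = s j \<and> t' j = t j) \<longrightarrow> x s' t' = x s t)}"

lemma tail_class_self [simp]: "s \<in> tail_class k s"
  by (simp add: tail_class_def)

lemma tail_class_sym: "s \<in> tail_class k t \<longleftrightarrow> t \<in> tail_class k s"
  by (auto simp: tail_class_def)

lemma tail_class_trans: "s \<in> tail_class k t \<Longrightarrow> t \<in> tail_class k r \<Longrightarrow> s \<in> tail_class k r"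
  by (auto simp: tail_class_def)

lemma tail_class_eq: "s \<in> tail_class k t \<Longrightarrow> tail_class k s = tail_class k t"
  by (auto simp: tail_class_def)

lemma tail_class_mono: "k \<le> l \<Longrightarrow> tail_class k s \<subseteq> tail_class l s"
  by (auto simp: tail_class_def)

lemma tail_class_0 [simp]: "tail_class 0 s = {s}"
  by (auto simp: tail_class_def)

lemma tail_class_Suc: "tail_class (Suc k) s = (\<Union>c. tail_class k (s(k := c)))"
proof (intro equalityI subsetI)
  fix r assume "r \<in> tail_class (Suc k) s"
  then have "r \<in> tail_class k (s(k := r k))"
    by (auto simp: tail_class_def)
  then show "r \<in> (\<Union>c. tail_class k (s(k := c)))" by blast
qed (auto simp: tail_class_def)

lemma finite_tail_class [simp]: "finite (tail_class k (s :: nat \<Rightarrow> 'n::finite))"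
  by (induction k arbitrary: s) (simp_all add: tail_class_Suc)

lemma sum_tail_class_Suc:
  "(\<Sum>r\<in>tail_class (Suc k) (s :: nat \<Rightarrow> 'n::finite). f r) =
    (\<Sum>c\<in>UNIV. \<Sum>r\<in>tail_class k (s(k := c)). f r)"
  unfolding tail_class_Suc
proof (rule sum.UNION_disjoint)
  show "\<forall>c\<in>UNIV. \<forall>d\<in>UNIV. c \<noteq> d \<longrightarrow> tail_class k (s(k := c)) \<inter> tail_class k (s(k := d)) = {}"
    by (auto simp: tail_class_def)
qed simp_all

lemma card_tail_class: "card (tail_class k (s :: nat \<Rightarrow> 'n::finite)) = CARD('n) ^ k"
proof (induction k arbitrary: s)
  case (Suc k)
  have "card (tail_class (Suc k) s) = (\<Sum>c\<in>UNIV. \<Sum>r\<in>tail_class k (s(k := c)). 1)"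
    by (subst sum_tail_class_Suc [symmetric]) simp
  then show ?case by (simp add: Suc)
qed simp

lemma sum_tail_class_shift:
  assumes "\<And>r r'. r \<in> tail_class k s \<Longrightarrow> r' \<in> tail_class k s' \<Longrightarrow> (\<forall>j<k. r' j = r j) \<Longrightarrow> g r' = f r"
  shows "(\<Sum>r\<in>tail_class k s. f r) = (\<Sum>r\<in>tail_class k s'. g r)"
proof (rule sum.reindex_bij_witness [where
      i = "\<lambda>r j. if j < k then r j else s j" and j = "\<lambda>r j. if j < k then r j else s' j"])
  fix r assume r: "r \<in> tail_class k s"
  show "g (\<lambda>j. if j < k then r j else s' j) = f r"
    by (rule assms [OF r]) (auto simp: tail_class_def)
qed (auto simp: tail_class_def)

lemma kernels_zero: "x \<in> kernels k \<Longrightarrow> t \<notin> tail_class k s \<Longrightarrow> x s t = 0"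
  by (simp add: kernels_def)

lemma kernels_cong:
  "x \<in> kernels k \<Longrightarrow> t \<in> tail_class k s \<Longrightarrow> t' \<in> tail_class k s' \<Longrightarrow>
    (\<And>j. j < k \<Longrightarrow> s' j = s j) \<Longrightarrow> (\<And>j. j < k \<Longrightarrow> t' j = t j) \<Longrightarrow> x s' t' = x s t"
  unfolding kernels_def by blast

lemma kernelsI:
  assumes "\<And>s t. t \<notin> tail_class k s \<Longrightarrow> x s t = 0"
    and "\<And>s t s' t'. t \<in> tail_class k s \<Longrightarrow> t' \<in> tail_class k s' \<Longrightarrow>
      (\<And>j. j < k \<Longrightarrow> s' j = s j) \<Longrightarrow> (\<And>j. j < k \<Longrightarrow> t' j = t j) \<Longrightarrow> x s' t' = x s t"
  shows "x \<in> kernels k"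
  using assms unfolding kernels_def by blast

lemma kernels_mono:
  assumes "k \<le> l"
  shows "kernels k \<subseteq> kernels l"
proof
  fix x :: "(nat \<Rightarrow> 'a) \<Rightarrow> (nat \<Rightarrow> 'a) \<Rightarrow> complex"
  assume x: "x \<in> kernels k"
  show "x \<in> kernels l"
  proof (rule kernelsI)
    fix s t :: "nat \<Rightarrow> 'a" assume "t \<notin> tail_class l s"
    then show "x s t = 0"
      using tail_class_mono [OF assms] kernels_zero [OF x] by blast
  next
    fix s t s' t' :: "nat \<Rightarrow> 'a"
    assume t: "t \<in> tail_class l s" "t' \<in> tail_class l s'"
      and eq: "\<And>j. j < l \<Longrightarrow> s' j = s j" "\<And>j. j < l \<Longrightarrow> t' j = t j"
    have iff: "t \<in> tail_class k s \<longleftrightarrow> t' \<in> tail_class k s'"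
      using t eq by (simp add: tail_class_def) (metis not_less)
    show "x s' t' = x s t"
    proof (cases "t \<in> tail_class k s")
      case True
      show ?thesis
        by (rule kernels_cong [OF x True]) (use True iff eq assms in auto)
    next
      case False
      then show ?thesis using iff kernels_zero [OF x] by simp
    qed
  qed
qed

definition kernel_mult :: "('s \<Rightarrow> 's \<Rightarrow> complex) \<Rightarrow> ('s \<Rightarrow> 's \<Rightarrow> complex) \<Rightarrow> 's \<Rightarrow> 's \<Rightarrow> complex"
  where "kernel_mult x y s t = (\<Sum>r | x s r \<noteq> 0. x s r * y r t)"

lemma kernel_mult_eq:
  assumes "x \<in> kernels k"
  shows "kernel_mult x y s t = (\<Sum>r\<in>tail_class k s. x s r * y r t)"
  unfolding kernel_mult_def
  by (rule sum.mono_neutral_left) (use kernels_zero [OF assms] in auto)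

lemma kernels_mult:
  assumes x: "x \<in> kernels k" and y: "y \<in> kernels k"
  shows "kernel_mult x y \<in> kernels k"
proof (rule kernelsI)
  fix s t :: "nat \<Rightarrow> 'a" assume t: "t \<notin> tail_class k s"
  have "y r t = 0" if "r \<in> tail_class k s" for r
    using t that tail_class_trans kernels_zero [OF y] by blast
  then show "kernel_mult x y s t = 0" by (simp add: kernel_mult_eq [OF x])
next
  fix s t s' t' :: "nat \<Rightarrow> 'a"
  assume t: "t \<in> tail_class k s" "t' \<in> tail_class k s'"
    and eq: "\<And>j. j < k \<Longrightarrow> s' j = s j" "\<And>j. j < k \<Longrightarrow> t' j = t j"
  show "kernel_mult x y s' t' = kernel_mult x y s t"
    unfolding kernel_mult_eq [OF x]
  proof (rule sum_tail_class_shift [symmetric])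
    fix r r' assume r: "r \<in> tail_class k s" "r' \<in> tail_class k s'" "\<forall>j<k. r' j = r j"
    have "x s' r' = x s r"
      by (rule kernels_cong [OF x]) (use r eq in auto)
    moreover have "y r' t' = y r t"
      by (rule kernels_cong [OF y]) (use r t eq in \<open>auto simp: tail_class_def\<close>)
    ultimately show "x s' r' * y r' t' = x s r * y r t" by simp
  qed
qed

lemma kernel_mult_assoc:
  assumes x: "x \<in> kernels k" and y: "y \<in> kernels k"
  shows "kernel_mult (kernel_mult x y) z = kernel_mult x (kernel_mult y z)"
proof (intro ext)
  fix s t
  have "kernel_mult (kernel_mult x y) z s t =
      (\<Sum>r\<in>tail_class k s. \<Sum>q\<in>tail_class k s. x s q * y q r * z r t)"
    by (simp add: kernel_mult_eq [OF kernels_mult [OF x y]] kernel_mult_eq [OF x] sum_distrib_right)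
  also have "\<dots> = (\<Sum>q\<in>tail_class k s. \<Sum>r\<in>tail_class k s. x s q * y q r * z r t)"
    by (rule sum.swap)
  also have "\<dots> = kernel_mult x (kernel_mult y z) s t"
    by (auto simp: kernel_mult_eq [OF x] kernel_mult_eq [OF y] sum_distrib_left mult.assoc
        tail_class_eq intro!: sum.cong)
  finally show "kernel_mult (kernel_mult x y) z s t = kernel_mult x (kernel_mult y z) s t" .
qed

lemma kernels_plus: "x \<in> kernels k \<Longrightarrow> y \<in> kernels k \<Longrightarrow> (\<lambda>s t. x s t + y s t) \<in> kernels k"
  by (rule kernelsI) (auto simp: kernels_zero intro!: arg_cong2 [of _ _ _ _ "(+)"] elim: kernels_cong)

lemma kernels_scale: "x \<in> kernels k \<Longrightarrow> (\<lambda>s t. c * x s t) \<in> kernels k"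
  by (rule kernelsI) (simp add: kernels_zero, rule arg_cong [of _ _ "(*) c"], erule kernels_cong)

lemma kernels_star:
  assumes "x \<in> kernels k"
  shows "(\<lambda>s t. cnj (x t s)) \<in> kernels k"
proof (rule kernelsI)
  show "cnj (x t s) = 0" if "t \<notin> tail_class k s" for s t
    using that by (simp add: kernels_zero [OF assms] tail_class_sym [of s])
  show "cnj (x t' s') = cnj (x t s)" if "t \<in> tail_class k s" "t' \<in> tail_class k s'"
    "\<And>j. j < k \<Longrightarrow> s' j = s j" "\<And>j. j < k \<Longrightarrow> t' j = t j" for s t s' t'
    by (subst kernels_cong [OF assms, of s t s' t']) (use that tail_class_sym in blast)+
qed

lemma kernels_one: "(\<lambda>s t. of_bool (s = t)) \<in> kernels 0"
  by (rule kernelsI) auto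

lemma kernels_tensor:
  assumes "x \<in> kernels k"
  shows "(\<lambda>s t. a (s 0) (t 0) * x (s \<circ> Suc) (t \<circ> Suc)) \<in> kernels (Suc k)"
proof (rule kernelsI)
  have *: "t \<circ> Suc \<in> tail_class k (s \<circ> Suc) \<longleftrightarrow> t \<in> tail_class (Suc k) s" for s t :: "nat \<Rightarrow> 'a"
    by (auto simp: tail_class_def Suc_le_eq) (metis Suc_le_D Suc_le_mono less_eq_Suc_le)
  show "a (s 0) (t 0) * x (s \<circ> Suc) (t \<circ> Suc) = 0" if "t \<notin> tail_class (Suc k) s" for s t
    using that by (simp add: kernels_zero [OF assms] *)
  show "a (s' 0) (t' 0) * x (s' \<circ> Suc) (t' \<circ> Suc) = a (s 0) (t 0) * x (s \<circ> Suc) (t \<circ> Suc)"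
    if "t \<in> tail_class (Suc k) s" "t' \<in> tail_class (Suc k) s'"
      "\<And>j. j < Suc k \<Longrightarrow> s' j = s j" "\<And>j. j < Suc k \<Longrightarrow> t' j = t j" for s t s' t'
    by (subst kernels_cong [OF assms, of "t \<circ> Suc" "s \<circ> Suc" "t' \<circ> Suc" "s' \<circ> Suc"])
      (use that * in auto)
qed

typedef 'n uhf = "\<Union>k. kernels k :: ((nat \<Rightarrow> 'n::finite) \<Rightarrow> (nat \<Rightarrow> 'n) \<Rightarrow> complex) set"
  morphisms entry Abs_uhf
  using kernels_one by blast

setup_lifting type_definition_uhf

definition tensor_power :: "nat \<Rightarrow> 'n::finite uhf set" where
  "tensor_power k = {x. entry x \<in> kernels k}"

lemma common_kernels:
  assumes "x \<in> (\<Union>k. kernels k)" "y \<in> (\<Union>k. kernels k)"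
  obtains k where "x \<in> kernels k" "y \<in> kernels k"
proof -
  obtain k l where "x \<in> kernels k" "y \<in> kernels l" using assms by blast
  then have "x \<in> kernels (max k l)" "y \<in> kernels (max k l)"
    using kernels_mono [of k "max k l"] kernels_mono [of l "max k l"] by auto
  then show ?thesis by (rule that)
qed

lemma tensor_power_mono: "k \<le> l \<Longrightarrow> tensor_power k \<subseteq> tensor_power l"
  using kernels_mono by (auto simp: tensor_power_def)

lemma tensor_power_ex: "\<exists>k. x \<in> tensor_power k"
  using entry [of x] by (auto simp: tensor_power_def)

lemma tensor_power_common: obtains k where "x \<in> tensor_power k" "y \<in> tensor_power k"
  using common_kernels [OF entry [of x] entry [of y]] by (auto simp: tensor_power_def)

instantiation uhf :: (finite) "{ring_1, complex_vector}"
begin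

lift_definition zero_uhf :: "'a uhf" is "\<lambda>s t. 0"
  using kernels_scale [OF kernels_one, of 0] by auto
lift_definition one_uhf :: "'a uhf" is "\<lambda>s t. of_bool (s = t)"
  using kernels_one by blast
lift_definition plus_uhf :: "'a uhf \<Rightarrow> 'a uhf \<Rightarrow> 'a uhf" is "\<lambda>x y s t. x s t + y s t"
  by (rule common_kernels) (assumption+, rule UN_I, rule UNIV_I, erule (1) kernels_plus)
lift_definition scaleC_uhf :: "complex \<Rightarrow> 'a uhf \<Rightarrow> 'a uhf" is "\<lambda>c x s t. c * x s t"
  by (erule UN_E) (rule UN_I, rule UNIV_I, erule kernels_scale)
lift_definition times_uhf :: "'a uhf \<Rightarrow> 'a uhf \<Rightarrow> 'a uhf" is kernel_mult
  by (rule common_kernels) (assumption+, rule UN_I, rule UNIV_I, erule (1) kernels_mult)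

definition scaleR_uhf :: "real \<Rightarrow> 'a uhf \<Rightarrow> 'a uhf" where
  "scaleR_uhf r x = of_real r *\<^sub>C x"
definition uminus_uhf :: "'a uhf \<Rightarrow> 'a uhf" where
  "uminus_uhf x = (-1) *\<^sub>C x"
definition minus_uhf :: "'a uhf \<Rightarrow> 'a uhf \<Rightarrow> 'a uhf" where
  "minus_uhf x y = x + - y"

instance
proof
  fix x y z :: "'a uhf" and b c :: complex and r r' :: real
  show "x + y + z = x + (y + z)" "x + y = y + x" "0 + x = x"
    by (transfer; simp add: add_ac)+
  show "- x + x = 0" unfolding uminus_uhf_def by transfer simp
  show "x - y = x + - y" by (rule minus_uhf_def)
  show sc: "c *\<^sub>C (x + y) = c *\<^sub>C x + c *\<^sub>C y" "(b + c) *\<^sub>C x = b *\<^sub>C x + c *\<^sub>C x"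
    "b *\<^sub>C c *\<^sub>C x = (b * c) *\<^sub>C x" for b c and x y :: "'a uhf"
    by (transfer; simp add: algebra_simps)+
  show "of_real r *\<^sub>C x = r *\<^sub>R x" by (simp add: scaleR_uhf_def)
  show "r *\<^sub>R (x + y) = r *\<^sub>R x + r *\<^sub>R y" "(r + r') *\<^sub>R x = r *\<^sub>R x + r' *\<^sub>R x"
    "r *\<^sub>R r' *\<^sub>R x = (r * r') *\<^sub>R x"
    by (simp_all add: scaleR_uhf_def sc)
  show "1 *\<^sub>R x = x" unfolding scaleR_uhf_def by transfer simp
  show "x * y * z = x * (y * z)"
  proof -
    obtain k where "entry x \<in> kernels k" "entry y \<in> kernels k"
      by (rule common_kernels [OF entry entry])
    then show ?thesis
      by (simp add: entry_inject [symmetric] times_uhf.rep_eq kernel_mult_assoc)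
  qed
  show "1 * x = x"
    by transfer (intro ext, simp add: kernel_mult_eq [OF kernels_one])
  show "x * 1 = x"
  proof -
    obtain k where x: "entry x \<in> kernels k" using entry [of x] by blast
    have "entry (x * 1) s t = (\<Sum>r\<in>tail_class k s. if r = t then entry x s t else 0)" for s t
      unfolding times_uhf.rep_eq one_uhf.rep_eq kernel_mult_eq [OF x] by (rule sum.cong) auto
    then have "entry (x * 1) s t = entry x s t" for s t
      by (simp add: kernels_zero [OF x])
    then show ?thesis by (simp add: entry_inject [symmetric] fun_eq_iff)
  qed
  show "(x + y) * z = x * z + y * z"
  proof -
    obtain k where k: "entry x \<in> kernels k" "entry y \<in> kernels k"
      by (rule common_kernels [OF entry entry])
    then have "entry (x + y) \<in> kernels k" by (simp add: plus_uhf.rep_eq kernels_plus)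
    with k show ?thesis
      by (simp add: entry_inject [symmetric] fun_eq_iff times_uhf.rep_eq plus_uhf.rep_eq
          kernel_mult_eq algebra_simps sum.distrib)
  qed
  show "x * (y + z) = x * y + x * z"
    by transfer (intro ext, simp add: kernel_mult_def algebra_simps sum.distrib)
  show "(0 :: 'a uhf) \<noteq> 1"
    by transfer (auto simp: fun_eq_iff)
qed

end

lift_definition star :: "'n::finite uhf \<Rightarrow> 'n uhf" is "\<lambda>x s t. cnj (x t s)"
  by (erule UN_E) (rule UN_I, rule UNIV_I, erule kernels_star)

text \<open>\<open>a \<otimes> x\<close> puts the matrix \<open>a\<close> in front of \<open>x\<close>; so \<open>a \<otimes> b \<otimes> 1\<close> is the usual \<open>a \<otimes> b\<close> and
  \<open>mat 1 \<otimes> x\<close> shifts \<open>x\<close> by one tensor factor.\<close>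

lift_definition tensor :: "complex^'n^'n \<Rightarrow> 'n::finite uhf \<Rightarrow> 'n uhf" (infixr \<open>\<otimes>\<close> 75)
  is "\<lambda>a x s t. a $ s 0 $ t 0 * x (s \<circ> Suc) (t \<circ> Suc)"
  by (erule UN_E) (rule UN_I, rule UNIV_I, erule kernels_tensor)

text \<open>The normalised trace; the summand and hence the value do not depend on the tail chosen for
  the summation index, nor on the level (lemma \<open>ntrace_eq\<close> below).\<close>

definition ntrace :: "'n::finite uhf \<Rightarrow> complex" where
  "ntrace x = (let k = (LEAST k. x \<in> tensor_power k)
     in (\<Sum>s\<in>tail_class k (\<lambda>_. undefined). entry x s s) / of_nat (CARD('n) ^ k))"

lemma ntrace_eq:
  fixes x :: "'n::finite uhf"
  assumes "x \<in> tensor_power k"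
  shows "ntrace x = (\<Sum>s\<in>tail_class k s0. entry x s s) / of_nat (CARD('n) ^ k)"
proof -
  define l where "l = (LEAST k. x \<in> tensor_power k)"
  have x: "entry x \<in> kernels l"
    using LeastI_ex [OF tensor_power_ex [of x]] by (simp add: l_def tensor_power_def)
  have "l \<le> k" unfolding l_def using assms by (rule Least_le)
  have shift: "(\<Sum>s\<in>tail_class l s1. entry x s s) = (\<Sum>s\<in>tail_class l s2. entry x s s)" for s1 s2
    by (rule sum_tail_class_shift) (rule kernels_cong [OF x]; simp)
  have "(\<Sum>s\<in>tail_class (l + d) s0. entry x s s) / of_nat (CARD('n) ^ (l + d)) = ntrace x" for d s0
  proof (induction d arbitrary: s0)
    case 0
    then show ?case by (simp add: ntrace_def flip: l_def) (simp add: shift [of s0])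
  next
    case (Suc d)
    have "(\<Sum>s\<in>tail_class (l + Suc d) s0. entry x s s) / of_nat (CARD('n) ^ (l + Suc d)) =
        (\<Sum>c\<in>UNIV. (\<Sum>s\<in>tail_class (l + d) (s0(l + d := c)). entry x s s) / of_nat (CARD('n) ^ (l + d)))
          / of_nat CARD('n)"
      by (simp add: sum_tail_class_Suc sum_divide_distrib [symmetric])
    also have "\<dots> = (\<Sum>c\<in>(UNIV :: 'n set). ntrace x) / of_nat CARD('n)"
      by (simp only: Suc)
    finally show ?case by simp
  qed
  from this [of "k - l" s0] \<open>l \<le> k\<close> show ?thesis by simp
qed

lemma entry_mult:
  "x \<in> tensor_power k \<Longrightarrow> entry (x * y) s t = (\<Sum>r\<in>tail_class k s. entry x s r * entry y r t)"
  by (simp add: times_uhf.rep_eq kernel_mult_eq tensor_power_def)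

lemma tensor_power_mult: "x \<in> tensor_power k \<Longrightarrow> y \<in> tensor_power k \<Longrightarrow> x * y \<in> tensor_power k"
  by (simp add: times_uhf.rep_eq kernels_mult tensor_power_def)

lemma tensor_power_star: "x \<in> tensor_power k \<Longrightarrow> star x \<in> tensor_power k"
  by (simp add: star.rep_eq kernels_star tensor_power_def)

lemma tensor_power_add: "x \<in> tensor_power k \<Longrightarrow> y \<in> tensor_power k \<Longrightarrow> x + y \<in> tensor_power k"
  by (simp add: plus_uhf.rep_eq kernels_plus tensor_power_def)

lemma tensor_power_scaleC: "x \<in> tensor_power k \<Longrightarrow> c *\<^sub>C x \<in> tensor_power k"
  by (simp add: scaleC_uhf.rep_eq kernels_scale tensor_power_def)

lemma ntrace_add: "ntrace (x + y) = ntrace x + ntrace y"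
proof -
  obtain k where k: "x \<in> tensor_power k" "y \<in> tensor_power k" by (rule tensor_power_common)
  show ?thesis
    by (simp only: ntrace_eq [OF k(1), of undefined] ntrace_eq [OF k(2), of undefined]
        ntrace_eq [OF tensor_power_add [OF k], of undefined])
      (simp add: plus_uhf.rep_eq sum.distrib add_divide_distrib)
qed

lemma ntrace_scaleC: "ntrace (c *\<^sub>C x) = c * ntrace x"
proof -
  obtain k where k: "x \<in> tensor_power k" using tensor_power_ex by blast
  show ?thesis
    by (simp only: ntrace_eq [OF k, of undefined] ntrace_eq [OF tensor_power_scaleC [OF k], where ?s0.0 = undefined])
      (simp add: scaleC_uhf.rep_eq sum_distrib_left)
qed

lemma ntrace_star: "ntrace (star x) = cnj (ntrace x)"
proof -
  obtain k where k: "x \<in> tensor_power k" using tensor_power_ex by blast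
  show ?thesis
    by (simp only: ntrace_eq [OF k, of undefined] ntrace_eq [OF tensor_power_star [OF k], of undefined])
      (simp add: star.rep_eq)
qed

lemma star_star [simp]: "star (star x) = x"
  by transfer simp

lemma star_mult: "star (x * y) = star y * star x"
proof -
  obtain k where k: "x \<in> tensor_power k" "y \<in> tensor_power k" by (rule tensor_power_common)
  have "entry (star (x * y)) s t = entry (star y * star x) s t" for s t
  proof (cases "t \<in> tail_class k s")
    case True
    then show ?thesis
      by (simp add: star.rep_eq entry_mult [OF k(1)] entry_mult [OF tensor_power_star [OF k(2)]]
          tail_class_eq mult.commute)
  next
    case False
    moreover have "star (x * y) \<in> tensor_power k" "star y * star x \<in> tensor_power k"
      by (intro tensor_power_star tensor_power_mult k)+
    ultimately show ?thesis
      by (simp add: tensor_power_def kernels_zero)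
  qed
  then show ?thesis by (simp add: entry_inject [symmetric] fun_eq_iff)
qed

lemma mult_scaleC: "(c *\<^sub>C x) * y = c *\<^sub>C (x * (y :: 'n::finite uhf))"
    "x * (c *\<^sub>C y) = c *\<^sub>C (x * (y :: 'n::finite uhf))"
proof -
  obtain k where k: "x \<in> tensor_power k" using tensor_power_ex by blast
  show "(c *\<^sub>C x) * y = c *\<^sub>C (x * y)" "x * (c *\<^sub>C y) = c *\<^sub>C (x * y)"
    by (simp_all add: entry_inject [symmetric] fun_eq_iff entry_mult [OF k]
        entry_mult [OF tensor_power_scaleC [OF k]] scaleC_uhf.rep_eq sum_distrib_left mult_ac)
qed

lemma ntrace_star_mult_self:
  fixes x :: "'n::finite uhf"
  assumes k: "x \<in> tensor_power k"
  shows "ntrace (star x * x) =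
    of_real ((\<Sum>s\<in>tail_class k s0. \<Sum>r\<in>tail_class k s0. (cmod (entry x r s))\<^sup>2) / real (CARD('n) ^ k))"
  unfolding ntrace_eq [OF tensor_power_mult [OF tensor_power_star [OF k] k], of s0]
  by (simp add: entry_mult [OF tensor_power_star [OF k]] star.rep_eq tail_class_eq
      complex_norm_square [symmetric] mult.commute [of "cnj _"] del: of_nat_power cong: sum.cong)

instantiation uhf :: (finite) complex_inner
begin

definition cinner_uhf :: "'a uhf \<Rightarrow> 'a uhf \<Rightarrow> complex" where
  "cinner_uhf x y = ntrace (star y * x)"
definition inner_uhf :: "'a uhf \<Rightarrow> 'a uhf \<Rightarrow> real" where
  "inner_uhf x y = Re (cinner x y)"
definition norm_uhf :: "'a uhf \<Rightarrow> real" where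
  "norm_uhf x = sqrt (inner x x)"
definition sgn_uhf :: "'a uhf \<Rightarrow> 'a uhf" where
  "sgn_uhf x = inverse (norm x) *\<^sub>R x"
definition dist_uhf :: "'a uhf \<Rightarrow> 'a uhf \<Rightarrow> real" where
  "dist_uhf x y = norm (x - y)"
definition uniformity_uhf :: "('a uhf \<times> 'a uhf) filter" where
  "uniformity_uhf = (INF e\<in>{0<..}. principal {(x, y). dist x y < e})"
definition open_uhf :: "'a uhf set \<Rightarrow> bool" where
  "open_uhf U = (\<forall>x\<in>U. eventually (\<lambda>(x', y). x' = x \<longrightarrow> y \<in> U) uniformity)"

instance
proof
  fix x y z :: "'a uhf" and c :: complex and r :: real
  show "sgn x = inverse (norm x) *\<^sub>R x" by (rule sgn_uhf_def)
  show "dist x y = norm (x - y)" by (rule dist_uhf_def)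
  show "uniformity = (INF e\<in>{0<..}. principal {(x :: 'a uhf, y). dist x y < e})"
    by (rule uniformity_uhf_def)
  show "open U = (\<forall>x\<in>U. eventually (\<lambda>(x', y). x' = x \<longrightarrow> y \<in> U) uniformity)"
    for U :: "'a uhf set"
    by (rule open_uhf_def)
  show add: "cinner (x + y) z = cinner x z + cinner y z"
    by (simp add: cinner_uhf_def distrib_left ntrace_add)
  show scC: "cinner (c *\<^sub>C x) y = c * cinner x y" for c
    by (simp add: cinner_uhf_def mult_scaleC ntrace_scaleC)
  show comm: "cinner x y = cnj (cinner y x)"
    by (simp add: cinner_uhf_def ntrace_star [symmetric] star_mult)
  show "Re (cinner x y) = inner x y" by (simp add: inner_uhf_def)
  show "inner x y = inner y x" unfolding inner_uhf_def by (subst comm) simp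
  show "inner (x + y) z = inner x z + inner y z" by (simp add: inner_uhf_def add)
  show "inner (r *\<^sub>R x) y = r * inner x y" by (simp add: inner_uhf_def scaleR_uhf_def scC)
  show "norm x = sqrt (inner x x)" by (rule norm_uhf_def)
  obtain k where k: "x \<in> tensor_power k" using tensor_power_ex by blast
  have xx: "inner x x =
      (\<Sum>s\<in>tail_class k s0. \<Sum>r\<in>tail_class k s0. (cmod (entry x r s))\<^sup>2) / real (CARD('a) ^ k)" for s0
    by (simp only: inner_uhf_def cinner_uhf_def ntrace_star_mult_self [OF k, of s0] Re_complex_of_real)
  show "0 \<le> inner x x"
    unfolding xx [of undefined] by (intro divide_nonneg_nonneg sum_nonneg) auto
  show "inner x x = 0 \<longleftrightarrow> x = 0"
  proof
    assume 0: "inner x x = 0"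
    have "entry x r s = 0" for r s
    proof (cases "r \<in> tail_class k s")
      case True
      have "(\<Sum>t\<in>tail_class k s. \<Sum>r\<in>tail_class k s. (cmod (entry x r t))\<^sup>2) = 0"
        using 0 unfolding xx [of s] by simp
      then have "\<forall>t\<in>tail_class k s. (\<Sum>r\<in>tail_class k s. (cmod (entry x r t))\<^sup>2) = 0"
        by (subst (asm) sum_nonneg_eq_0_iff) (auto intro: sum_nonneg)
      then have "(\<Sum>r\<in>tail_class k s. (cmod (entry x r s))\<^sup>2) = 0" by simp
      then show ?thesis using True by (subst (asm) sum_nonneg_eq_0_iff) auto
    next
      case False
      then show ?thesis
        using k by (simp add: tensor_power_def kernels_zero tail_class_sym [of s])
    qed
    then show "x = 0" by (simp add: entry_inject [symmetric] fun_eq_iff zero_uhf.rep_eq)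
  next
    assume "x = 0"
    then have "entry x = (\<lambda>s t. 0)" by (simp add: zero_uhf.rep_eq)
    then show "inner x x = 0" by (simp only: xx [of undefined]) simp
  qed
qed

end

section \<open>The GNS representation of the trace\<close>

lemma sum_tail_class_nested:
  fixes f :: "(nat \<Rightarrow> 'n::finite) \<Rightarrow> real"
  assumes "k \<le> m"
  shows "(\<Sum>s\<in>tail_class m s0. \<Sum>r\<in>tail_class k s. f r) = real (CARD('n) ^ k) * (\<Sum>r\<in>tail_class m s0. f r)"
proof -
  have *: "tail_class k s = {r \<in> tail_class m s0. r \<in> tail_class k s}" if "s \<in> tail_class m s0" for s
    using tail_class_mono [OF assms] that tail_class_eq by blast
  have **: "{s \<in> tail_class m s0. r \<in> tail_class k s} = tail_class k r" if "r \<in> tail_class m s0" for r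
    using * [OF that] tail_class_sym [of r k] by blast
  have "(\<Sum>s\<in>tail_class m s0. \<Sum>r\<in>tail_class k s. f r) =
      (\<Sum>s\<in>tail_class m s0. \<Sum>r | r \<in> tail_class m s0 \<and> r \<in> tail_class k s. f r)"
    using * by (intro sum.cong) auto
  also have "\<dots> = (\<Sum>r\<in>tail_class m s0. \<Sum>s | s \<in> tail_class m s0 \<and> r \<in> tail_class k s. f r)"
    by (rule sum.swap_restrict) simp_all
  also have "\<dots> = (\<Sum>r\<in>tail_class m s0. real (CARD('n) ^ k) * f r)"
    by (intro sum.cong) (simp_all add: ** card_tail_class)
  finally show ?thesis by (simp add: sum_distrib_left)
qed

lemma entry_bounded: "\<exists>A\<ge>0. \<forall>s t. cmod (entry x s t) \<le> A"
proof -
  obtain k where k: "entry x \<in> kernels k" using entry [of x] by blast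
  let ?W = "tail_class k (\<lambda>_. undefined)"
  let ?A = "\<Sum>s\<in>?W. \<Sum>t\<in>?W. cmod (entry x s t)"
  have "cmod (entry x s t) \<le> ?A" for s t
  proof (cases "t \<in> tail_class k s")
    case True
    define c where "c = (\<lambda>r :: nat \<Rightarrow> 'a. \<lambda>j. if j < k then r j else undefined)"
    have c: "c r \<in> ?W" for r by (simp add: c_def tail_class_def)
    have "entry x s t = entry x (c s) (c t)"
      by (rule kernels_cong [OF k, symmetric]) (use True in \<open>auto simp: c_def tail_class_def\<close>)
    moreover have "cmod (entry x (c s) (c t)) \<le> (\<Sum>t\<in>?W. cmod (entry x (c s) t))"
      by (rule member_le_sum) (simp_all add: c)
    moreover have "\<dots> \<le> ?A"
      by (rule member_le_sum [where f = "\<lambda>s. \<Sum>t\<in>?W. cmod (entry x s t)"])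
        (simp_all add: c sum_nonneg)
    ultimately show ?thesis by simp
  qed (simp add: kernels_zero [OF k] sum_nonneg)
  moreover have "0 \<le> ?A" by (intro sum_nonneg) simp
  ultimately show ?thesis by blast
qed

lemma power2_norm_uhf:
  fixes x :: "'n::finite uhf"
  assumes "x \<in> tensor_power k"
  shows "(norm x)\<^sup>2 =
    (\<Sum>s\<in>tail_class k s0. \<Sum>r\<in>tail_class k s0. (cmod (entry x r s))\<^sup>2) / real (CARD('n) ^ k)"
  using arg_cong [OF ntrace_star_mult_self [OF assms, of s0], of Re]
  by (simp only: power2_norm_eq_inner inner_uhf_def cinner_uhf_def Re_complex_of_real)

lemma bounded_left_mult: "\<exists>C. \<forall>x. norm (a * x) \<le> C * norm (x :: 'n::finite uhf)"
proof -
  obtain k where k: "a \<in> tensor_power k" using tensor_power_ex by blast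
  obtain A where A: "A \<ge> 0" "\<And>s t. cmod (entry a s t) \<le> A" using entry_bounded [of a] by blast
  let ?N = "real (CARD('n) ^ k)"
  have "norm (a * x) \<le> A * ?N * norm x" for x
  proof -
    obtain l where l: "x \<in> tensor_power l" using tensor_power_ex by blast
    define m where "m = max k l"
    have m: "k \<le> m" "a \<in> tensor_power m" "x \<in> tensor_power m"
      using k l tensor_power_mono [of k m] tensor_power_mono [of l m] by (auto simp: m_def)
    let ?W = "tail_class m (\<lambda>_. undefined)"
    have 1: "(cmod (entry (a * x) s t))\<^sup>2 \<le> A\<^sup>2 * ?N * (\<Sum>r\<in>tail_class k s. (cmod (entry x r t))\<^sup>2)" for s t
    proof -
      have "cmod (entry (a * x) s t) \<le> (\<Sum>r\<in>tail_class k s. A * cmod (entry x r t))"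
        unfolding entry_mult [OF k]
        by (rule order_trans [OF norm_sum sum_mono]) (simp add: norm_mult mult_right_mono A)
      also have "\<dots> = A * (\<Sum>r\<in>tail_class k s. cmod (entry x r t))"
        by (simp add: sum_distrib_left)
      finally have "(cmod (entry (a * x) s t))\<^sup>2 \<le> (A * (\<Sum>r\<in>tail_class k s. cmod (entry x r t)))\<^sup>2"
        by (rule power_mono) simp
      also have "\<dots> = A\<^sup>2 * (\<Sum>r\<in>tail_class k s. cmod (entry x r t))\<^sup>2"
        by (rule power_mult_distrib)
      also have "\<dots> \<le> A\<^sup>2 * ((\<Sum>r\<in>tail_class k s. (cmod (entry x r t))\<^sup>2) * real (card (tail_class k s)))"
        by (rule mult_left_mono [OF sum_squared_le_sum_of_squares]) simp
      finally show ?thesis by (simp add: card_tail_class mult_ac)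
    qed
    have "(\<Sum>t\<in>?W. \<Sum>s\<in>?W. (cmod (entry (a * x) s t))\<^sup>2) \<le>
        (\<Sum>t\<in>?W. \<Sum>s\<in>?W. A\<^sup>2 * ?N * (\<Sum>r\<in>tail_class k s. (cmod (entry x r t))\<^sup>2))"
      by (intro sum_mono 1)
    also have "\<dots> = (A * ?N)\<^sup>2 * (\<Sum>t\<in>?W. \<Sum>r\<in>?W. (cmod (entry x r t))\<^sup>2)"
      by (simp add: sum_distrib_left [symmetric] sum_tail_class_nested [OF m(1)] power2_eq_square)
    finally have "(norm (a * x))\<^sup>2 \<le> (A * ?N * norm x)\<^sup>2"
      unfolding power_mult_distrib [of _ "norm x"]
        power2_norm_uhf [OF tensor_power_mult [OF m(2,3)], of "\<lambda>_. undefined"]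
        power2_norm_uhf [OF m(3), of "\<lambda>_. undefined"]
      by (simp add: divide_right_mono)
    then show ?thesis using A by (simp add: power2_le_iff_abs_le abs_mult)
  qed
  then show ?thesis by blast
qed

lemma scaleR_mult_uhf: "x * (r *\<^sub>R y) = r *\<^sub>R (x * (y :: 'n::finite uhf))"
  by (simp add: scaleC_of_real [symmetric] mult_scaleC)

lemma bounded_linear_left_mult: "bounded_linear (\<lambda>x :: 'n::finite uhf. a * x)"
proof -
  obtain C where "\<And>x :: 'n uhf. norm (a * x) \<le> C * norm x" using bounded_left_mult by blast
  then show ?thesis
    by (intro bounded_linear_intro [where K = C])
      (simp_all add: distrib_left scaleR_mult_uhf mult.commute [of "norm _" C])
qed

type_synonym 'n gns = "'n uhf hcompletion"

definition gns_rep :: "'n::finite uhf \<Rightarrow> ('n gns \<Rightarrow>\<^sub>L 'n gns)" where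
  "gns_rep a = (THE T. \<forall>x. blinfun_apply T (embed x) = embed (a * x))"

lemma gns_rep_embed: "gns_rep a (embed x) = embed (a * x)" for a :: "'n::finite uhf"
proof -
  have ex: "\<exists>T. \<forall>x. blinfun_apply T (embed x) = embed (a * x)"
  proof -
    define L where "L = Blinfun (\<lambda>x :: 'n uhf. star a * x)"
    have L: "blinfun_apply L x = star a * x" for x
      by (simp add: L_def bounded_linear_Blinfun_apply bounded_linear_left_mult)
    have rL: "riesz x o\<^sub>L L = riesz (a * x)" for x
      by (rule blinfun_eqI) (simp add: riesz.rep_eq L cinner_uhf_def star_mult mult.assoc)
    have bl: "bounded_linear (\<lambda>f :: 'n uhf \<Rightarrow>\<^sub>L complex. f o\<^sub>L L)"
      by (rule bounded_bilinear.bounded_linear_left [OF bounded_bilinear_blinfun_compose])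
    define F where "F = (\<lambda>h :: 'n gns. Abs_hcompletion (functional_of h o\<^sub>L L))"
    have "(\<lambda>f. f o\<^sub>L L) ` closure (range (riesz :: 'n uhf \<Rightarrow> _)) \<subseteq> closure ((\<lambda>f. f o\<^sub>L L) ` range riesz)"
      by (rule closure_bounded_linear_image_subset [OF bl])
    also have "\<dots> \<subseteq> closure (range riesz)"
      by (rule closure_mono) (auto simp: rL)
    finally have "functional_of h o\<^sub>L L \<in> closure (range riesz)" for h :: "'n gns"
      using functional_of [of h] by blast
    then have F: "functional_of (F h) = functional_of h o\<^sub>L L" for h
      by (simp add: F_def Abs_hcompletion_inverse)
    have "bounded_linear F"
    proof (rule bounded_linear_intro [where K = "norm L"])
      fix g h :: "'n gns" and r :: real
      show "F (g + h) = F g + F h"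
        by (simp add: functional_of_inject [symmetric] F plus_hcompletion.rep_eq
            linear_add [OF bounded_linear.linear [OF bl]])
      show "F (r *\<^sub>R h) = r *\<^sub>R F h"
        by (simp add: functional_of_inject [symmetric] F scaleR_hcompletion.rep_eq
            linear_scale [OF bounded_linear.linear [OF bl]])
      show "norm (F h) \<le> norm h * norm L"
        by (simp add: norm_hcompletion.rep_eq F norm_blinfun_compose)
    qed
    moreover have "F (embed x) = embed (a * x)" for x
      by (simp add: functional_of_inject [symmetric] F embed.rep_eq rL)
    ultimately show ?thesis
      by (intro exI [of _ "Blinfun F"]) (simp add: bounded_linear_Blinfun_apply)
  qed
  have uniq: "S = T" if ST: "\<forall>x. blinfun_apply S (embed x) = embed (a * x)" "\<forall>x. blinfun_apply T (embed x) = embed (a * x)"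
    for S T :: "'n gns \<Rightarrow>\<^sub>L 'n gns"
  proof (rule blinfun_eqI)
    fix h :: "'n gns"
    have "h \<in> closure (range embed)" by (simp add: closure_range_embed)
    moreover have "continuous_on (closure (range embed)) (\<lambda>h. (S - T) h)"
      by (rule linear_continuous_on [OF blinfun.bounded_linear_right])
    moreover have "(S - T) h = 0" if "h \<in> range embed" for h
      using that ST by (auto simp: blinfun.diff_left)
    ultimately have "(S - T) h = 0"
      using continuous_constant_on_closure by blast
    then show "S h = T h" by (simp add: blinfun.diff_left)
  qed
  show ?thesis
    using theI' [of "\<lambda>T. \<forall>x. blinfun_apply T (embed x) = embed (a * x)"] ex uniq
    unfolding gns_rep_def by blast
qed

definition trace_vector :: "'n::finite gns" where
  "trace_vector = embed 1"

definition vector_trace :: "('n::finite gns \<Rightarrow>\<^sub>L 'n gns) \<Rightarrow> complex" where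
  "vector_trace T = cinner (T trace_vector) trace_vector"


section \<open>Von Neumann algebras\<close>

text \<open>Bounded operators are the complex-linear members of the library type of bounded real-linear
  maps; the norm of that type is then the operator norm.\<close>

definition clinear_ops :: "('h::complex_hilbert \<Rightarrow>\<^sub>L 'h) set" where
  "clinear_ops = {T. \<forall>c x. blinfun_apply T (c *\<^sub>C x) = c *\<^sub>C T x}"

lift_definition scalar_op :: "complex \<Rightarrow> ('h::complex_hilbert \<Rightarrow>\<^sub>L 'h)" is "\<lambda>c x. c *\<^sub>C x"
proof -
  fix c :: complex
  have "c *\<^sub>C (r *\<^sub>R x) = r *\<^sub>R (c *\<^sub>C x)" for r :: real and x :: 'h
    by (simp add: scaleC_of_real [symmetric] scaleC_scaleC mult.commute)
  then show "bounded_linear (\<lambda>x :: 'h. c *\<^sub>C x)"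
    by (intro bounded_linear_intro [where K = "cmod c"])
      (simp_all add: scaleC_add_right norm_scaleC)
qed

definition adj :: "('h::complex_hilbert \<Rightarrow>\<^sub>L 'h) \<Rightarrow> ('h \<Rightarrow>\<^sub>L 'h)" where
  "adj T = (THE S. \<forall>x y. cinner (T x) y = cinner x (blinfun_apply S y))"

definition positive_op :: "('h::complex_hilbert \<Rightarrow>\<^sub>L 'h) \<Rightarrow> bool" where
  "positive_op T \<longleftrightarrow> (\<forall>x. cinner (T x) x \<in> \<real>\<^sub>\<ge>\<^sub>0)"

text \<open>The function space carries the product topology, so this is the coarsest topology making all
  matrix coefficients continuous.\<close>

definition weak_operator_topology :: "('h::complex_hilbert \<Rightarrow>\<^sub>L 'h) topology" where
  "weak_operator_topology = pullback_topology UNIV (\<lambda>T (x, y). cinner (blinfun_apply T x) y) euclidean"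

definition von_neumann_algebra :: "('h::complex_hilbert \<Rightarrow>\<^sub>L 'h) set \<Rightarrow> bool" where
  "von_neumann_algebra M \<longleftrightarrow>
     M \<subseteq> clinear_ops \<and> (\<forall>c. scalar_op c \<in> M) \<and>
     (\<forall>S\<in>M. \<forall>T\<in>M. S + T \<in> M \<and> S o\<^sub>L T \<in> M) \<and> (\<forall>T\<in>M. adj T \<in> M) \<and>
     closedin weak_operator_topology M"

definition commutant :: "('h::complex_hilbert \<Rightarrow>\<^sub>L 'h) set \<Rightarrow> ('h \<Rightarrow>\<^sub>L 'h) set" where
  "commutant M = {T \<in> clinear_ops. \<forall>S\<in>M. T o\<^sub>L S = S o\<^sub>L T}"

definition factor :: "('h::complex_hilbert \<Rightarrow>\<^sub>L 'h) set \<Rightarrow> bool" where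
  "factor M \<longleftrightarrow> von_neumann_algebra M \<and> M \<inter> commutant M = range scalar_op"

definition finite_vna :: "('h::complex_hilbert \<Rightarrow>\<^sub>L 'h) set \<Rightarrow> bool" where
  "finite_vna M \<longleftrightarrow> (\<forall>V\<in>M. adj V o\<^sub>L V = id_blinfun \<longrightarrow> V o\<^sub>L adj V = id_blinfun)"

definition tracial_state :: "('h::complex_hilbert \<Rightarrow>\<^sub>L 'h) set \<Rightarrow> (('h \<Rightarrow>\<^sub>L 'h) \<Rightarrow> complex) \<Rightarrow> bool" where
  "tracial_state M t \<longleftrightarrow>
     (\<forall>S\<in>M. \<forall>T\<in>M. t (S + T) = t S + t T \<and> t (S o\<^sub>L T) = t (T o\<^sub>L S)) \<and>
     (\<forall>c. \<forall>T\<in>M. t (scalar_op c o\<^sub>L T) = c * t T) \<and>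
     t id_blinfun = 1 \<and> (\<forall>T\<in>M. positive_op T \<longrightarrow> t T \<in> \<real>\<^sub>\<ge>\<^sub>0)"

text \<open>A finite factor has exactly one tracial state, so on such a factor the choice below is
  immaterial.\<close>

definition factor_trace :: "('h::complex_hilbert \<Rightarrow>\<^sub>L 'h) set \<Rightarrow> ('h \<Rightarrow>\<^sub>L 'h) \<Rightarrow> real" where
  "factor_trace M T = Re ((SOME t. tracial_state M t) T)"

definition cyclic_projection :: "('h::complex_hilbert \<Rightarrow>\<^sub>L 'h) set \<Rightarrow> 'h \<Rightarrow> ('h \<Rightarrow>\<^sub>L 'h)" where
  "cyclic_projection M \<xi> = (THE P. \<forall>x. blinfun_apply P x \<in> closure ((\<lambda>T. blinfun_apply T \<xi>) ` M) \<and>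
     (\<forall>y\<in>closure ((\<lambda>T. blinfun_apply T \<xi>) ` M). cinner (x - P x) y = 0))"

text \<open>The Murray--von Neumann coupling constant (the dimension of the underlying Hilbert space over
  a finite factor): the quotient is the same for all nonzero vectors, and the value is infinite
  if the commutant is not finite.\<close>

definition coupling_constant :: "('h::complex_hilbert \<Rightarrow>\<^sub>L 'h) set \<Rightarrow> ennreal" where
  "coupling_constant N =
     (if finite_vna (commutant N)
      then THE c. \<forall>\<xi>. \<xi> \<noteq> 0 \<longrightarrow>
        c = ennreal (factor_trace N (cyclic_projection (commutant N) \<xi>)) /
            ennreal (factor_trace (commutant N) (cyclic_projection N \<xi>))
      else \<infinity>)"

definition conditional_expectation ::
  "(('h::complex_hilbert \<Rightarrow>\<^sub>L 'h) \<Rightarrow> complex) \<Rightarrow> ('h \<Rightarrow>\<^sub>L 'h) set \<Rightarrow> ('h \<Rightarrow>\<^sub>L 'h) set \<Rightarrow>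
    (('h \<Rightarrow>\<^sub>L 'h) \<Rightarrow> ('h \<Rightarrow>\<^sub>L 'h)) \<Rightarrow> bool" where
  "conditional_expectation \<tau> M N E \<longleftrightarrow>
     (\<forall>T\<in>M. E T \<in> N) \<and> (\<forall>T\<in>N. E T = T) \<and>
     (\<forall>S\<in>M. \<forall>T\<in>M. E (S + T) = E S + E T) \<and>
     (\<forall>c. \<forall>T\<in>M. E (scalar_op c o\<^sub>L T) = scalar_op c o\<^sub>L E T) \<and>
     (\<forall>A\<in>N. \<forall>B\<in>N. \<forall>T\<in>M. E (A o\<^sub>L T o\<^sub>L B) = A o\<^sub>L E T o\<^sub>L B) \<and>
     (\<forall>T\<in>M. positive_op T \<longrightarrow> positive_op (E T)) \<and>
     (\<forall>T\<in>M. \<tau> (E T) = \<tau> T)"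

definition commuting_square ::
  "(('h::complex_hilbert \<Rightarrow>\<^sub>L 'h) \<Rightarrow> complex) \<Rightarrow> ('h \<Rightarrow>\<^sub>L 'h) set \<Rightarrow> ('h \<Rightarrow>\<^sub>L 'h) set \<Rightarrow>
    ('h \<Rightarrow>\<^sub>L 'h) set \<Rightarrow> ('h \<Rightarrow>\<^sub>L 'h) set \<Rightarrow> bool" where
  "commuting_square \<tau> M P Q N \<longleftrightarrow>
     N \<subseteq> P \<and> N \<subseteq> Q \<and> P \<subseteq> M \<and> Q \<subseteq> M \<and>
     (\<exists>E\<^sub>N E\<^sub>P E\<^sub>Q. conditional_expectation \<tau> M N E\<^sub>N \<and> conditional_expectation \<tau> M P E\<^sub>P \<and>
        conditional_expectation \<tau> M Q E\<^sub>Q \<and>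
        (\<forall>T\<in>M. E\<^sub>P (E\<^sub>Q T) = E\<^sub>N T \<and> E\<^sub>Q (E\<^sub>P T) = E\<^sub>N T))"

definition hausdorff_distance :: "'a::metric_space set \<Rightarrow> 'a set \<Rightarrow> real" where
  "hausdorff_distance A B = max (SUP x\<in>A. infdist x B) (SUP y\<in>B. infdist y A)"

definition kk_distance :: "('h::complex_hilbert \<Rightarrow>\<^sub>L 'h) set \<Rightarrow> ('h \<Rightarrow>\<^sub>L 'h) set \<Rightarrow> real" where
  "kk_distance P Q = hausdorff_distance {T \<in> P. norm T \<le> 1} {T \<in> Q. norm T \<le> 1}"


section \<open>Hadamard unitaries and spin model subfactors\<close>

definition unitary_matrix :: "complex^'n^'n \<Rightarrow> bool" where
  "unitary_matrix u \<longleftrightarrow>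
     (let u' = (\<chi> i j. cnj (u $ j $ i)) in u ** u' = mat 1 \<and> u' ** u = mat 1)"

definition hadamard_unitary :: "complex^'n^'n \<Rightarrow> bool" where
  "hadamard_unitary u \<longleftrightarrow>
     unitary_matrix u \<and> (\<forall>i j. cmod (u $ i $ j) = 1 / sqrt (real CARD('n)))"

definition permutation_matrix :: "complex^'n^'n \<Rightarrow> bool" where
  "permutation_matrix P \<longleftrightarrow> (\<exists>p. p permutes UNIV \<and> P = (\<chi> i j. if i = p j then 1 else 0))"

definition diagonal_unitary :: "complex^'n^'n \<Rightarrow> bool" where
  "diagonal_unitary D \<longleftrightarrow> unitary_matrix D \<and> (\<forall>i j. i \<noteq> j \<longrightarrow> D $ i $ j = 0)"

definition bg_equiv :: "complex^'n^'n \<Rightarrow> complex^'n^'n \<Rightarrow> bool" (infix \<open>\<sim>\<^sub>B\<^sub>G\<close> 50) where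
  "u \<sim>\<^sub>B\<^sub>G v \<longleftrightarrow> (\<exists>P D. permutation_matrix P \<and> diagonal_unitary D \<and> v = u ** P ** D)"

definition matrix_unit :: "'n \<Rightarrow> 'n \<Rightarrow> complex^'n^'n" where
  "matrix_unit i j = (\<chi> p q. if p = i \<and> q = j then 1 else 0)"

definition D_op :: "complex^'n^'n \<Rightarrow> 'n::finite uhf" where
  "D_op u = complex_of_real (sqrt (real CARD('n))) *\<^sub>C
     (\<Sum>i\<in>UNIV. \<Sum>j\<in>UNIV. cnj (u $ i $ j) *\<^sub>C (matrix_unit j j \<otimes> matrix_unit i i \<otimes> 1))"

definition u1_op :: "complex^'n^'n \<Rightarrow> 'n::finite uhf" where
  "u1_op u = (u \<otimes> 1) * D_op u"

text \<open>\<open>u_odd u k\<close> is $u_{2k-1}$.\<close>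

definition u_odd :: "complex^'n^'n \<Rightarrow> nat \<Rightarrow> 'n::finite uhf" where
  "u_odd u k = prod_list (map (\<lambda>i. ((\<lambda>x. mat 1 \<otimes> x) ^^ i) (u1_op u)) [0..<k])"

definition hyperfinite_R :: "('n::finite gns \<Rightarrow>\<^sub>L 'n gns) set" where
  "hyperfinite_R = weak_operator_topology closure_of (gns_rep ` (\<Union>k. tensor_power k))"

definition spin_R :: "complex^'n^'n \<Rightarrow> ('n::finite gns \<Rightarrow>\<^sub>L 'n gns) set" where
  "spin_R u = weak_operator_topology closure_of
     (gns_rep ` (\<Union>k\<in>{1..}. (\<lambda>x. u_odd u k * x * star (u_odd u k)) ` tensor_power k))"

text \<open>The Jones index of \<open>N\<close> in the hyperfinite factor is the dimension over \<open>N\<close> of the standard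
  Hilbert space of the hyperfinite factor, which is the GNS space on which everything acts here.\<close>

definition jones_index_R :: "('n::finite gns \<Rightarrow>\<^sub>L 'n gns) set \<Rightarrow> ennreal" where
  "jones_index_R N = coupling_constant N"

definition finite_index_subfactor_R :: "('n::finite gns \<Rightarrow>\<^sub>L 'n gns) set \<Rightarrow> bool" where
  "finite_index_subfactor_R N \<longleftrightarrow> factor N \<and> N \<subseteq> hyperfinite_R \<and> jones_index_R N < \<infinity>"

end

theory Submission
  imports Defs
begin

text \<open>A commuting square formed by the spin model subfactors of inequivalent \<open>u\<close> and \<open>v\<close> forces their
  Kadison--Kastler distance to be 1. Everything is visible on the first tensor factor.
  There the trace-preserving expectation onto the subfactor of \<open>u\<close> is the expectation onto the maximal abelian algebra \<open>A = u \<Delta> u\<^sup>*\<close> (\<open>cond_exp_spin_R_matrix\<close>), which rests on an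
  orthogonality computation with the words \<open>u\<^bsub>2k-1\<^esub>\<close> (\<open>spin_word_orthogonal\<close>). So for a commuting
  square the matrix expectations onto \<open>A\<close> and \<open>B = v \<Delta> v\<^sup>*\<close> commute.

  Put \<open>g = u\<^sup>* v\<close>. The numbers \<open>S\<^bsub>jk\<^esub> = |g\<^bsub>jk\<^esub>|\<^sup>2\<close> form a doubly stochastic matrix, and commutation
  of the expectations implies \<open>S\<^bsub>jk\<^esub> = (S S\<^sup>T)\<^bsub>jl\<^esub>\<close> whenever \<open>S\<^bsub>lk\<^esub>\<close> is not 0
  (\<open>commuting_square_transition\<close>). Such a matrix either has an entry 1 in every row, in which case
  \<open>g\<close> is a permutation matrix times a diagonal unitary and \<open>u\<close>, \<open>v\<close> are equivalent
  (\<open>bg_equiv_if_monomial\<close>), or it has two equal rows \<open>j\<close> and \<open>l\<close>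
  (\<open>doubly_stochastic_equal_rows\<close>).

  In the second case let \<open>p\<^sub>j\<close>, \<open>p\<^sub>l\<close> be the corresponding minimal projections of \<open>A\<close>. Equal rows
  mean that the difference \<open>p\<^sub>j - p\<^sub>l\<close> has expectation 0 onto \<open>B\<close>. Take the symmetry \<open>w\<close> in \<open>A\<close> that
  is \<open>-1\<close> on \<open>p\<^sub>l\<close> and \<open>1\<close> elsewhere, and the vector \<open>\<xi>\<close> given by \<open>p\<^sub>j + p\<^sub>l\<close>. Then \<open>w \<xi>\<close> is orthogonal
  to \<open>Y \<xi>\<close> for every \<open>Y\<close> in the subfactor of \<open>v\<close>, so \<open>w\<close> has norm distance at least 1 from it
  (\<open>unitary_far_from_spin_R\<close>). As 0 lies in both unit balls, the distance is never more than 1.\<close>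

section \<open>Matrices in the infinite tensor power\<close>

definition dagger :: "complex^'n^'n \<Rightarrow> complex^'n^'n" where
  "dagger a = (\<chi> i j. cnj (a $ j $ i))"

lemma uhf_eqI: "(\<And>s t. entry x s t = entry y s t) \<Longrightarrow> x = y"
  by (simp add: entry_inject [symmetric] fun_eq_iff)

text \<open>Levels are split at the last letter by \<open>sum_tail_class_Suc\<close>; computations with \<open>\<otimes>\<close> need the
  split at the first letter instead.\<close>

lemma sum_tail_class_head:
  fixes f :: "'n::finite \<Rightarrow> (nat \<Rightarrow> 'n) \<Rightarrow> complex"
  shows "(\<Sum>r\<in>tail_class (Suc k) s. f (r 0) (r \<circ> Suc)) =
    (\<Sum>c\<in>UNIV. \<Sum>r\<in>tail_class k (s \<circ> Suc). f c r)"
proof -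
  have "(\<Sum>r\<in>tail_class (Suc k) s. f (r 0) (r \<circ> Suc)) =
      (\<Sum>(c, r)\<in>UNIV \<times> tail_class k (s \<circ> Suc). f c r)"
    by (rule sum.reindex_bij_witness [where i = "\<lambda>(c, r). case_nat c r" and j = "\<lambda>r. (r 0, r \<circ> Suc)"])
      (auto simp: tail_class_def fun_eq_iff split: nat.split)
  then show ?thesis by (simp add: sum.cartesian_product)
qed

lemma tensor_in_tensor_power: "x \<in> tensor_power k \<Longrightarrow> a \<otimes> x \<in> tensor_power (Suc k)"
  using kernels_tensor [of "entry x" k "\<lambda>i j. a $ i $ j"] by (simp add: tensor_power_def tensor.rep_eq)

lemma one_in_tensor_power: "1 \<in> tensor_power k"
  using kernels_mono [of 0 k] kernels_one by (auto simp: tensor_power_def one_uhf.rep_eq)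

lemma tensor_mult: "(a \<otimes> x) * (b \<otimes> y) = (a ** b) \<otimes> (x * y)"
proof -
  obtain k where k: "x \<in> tensor_power k" using tensor_power_ex by blast
  show ?thesis
  proof (rule uhf_eqI)
    fix s t :: "nat \<Rightarrow> 'a"
    have "entry ((a \<otimes> x) * (b \<otimes> y)) s t = (\<Sum>r\<in>tail_class (Suc k) s.
        (\<lambda>c q. a $ s 0 $ c * b $ c $ t 0 * (entry x (s \<circ> Suc) q * entry y q (t \<circ> Suc))) (r 0) (r \<circ> Suc))"
      by (simp add: entry_mult [OF tensor_in_tensor_power [OF k]] tensor.rep_eq mult_ac)
    also have "\<dots> = entry ((a ** b) \<otimes> (x * y)) s t"
      by (subst sum_tail_class_head)
        (simp add: tensor.rep_eq entry_mult [OF k] matrix_matrix_mult_def sum_product)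
    finally show "entry ((a \<otimes> x) * (b \<otimes> y)) s t = entry ((a ** b) \<otimes> (x * y)) s t" .
  qed
qed

lemma star_tensor: "star (a \<otimes> x) = dagger a \<otimes> star x"
  by (rule uhf_eqI) (simp add: star.rep_eq tensor.rep_eq dagger_def)

lemma tensor_one: "mat 1 \<otimes> 1 = 1"
proof (rule uhf_eqI)
  fix s t :: "nat \<Rightarrow> 'a"
  have "s = t \<longleftrightarrow> s 0 = t 0 \<and> s \<circ> Suc = t \<circ> Suc"
    by (auto simp: fun_eq_iff) (metis not0_implies_Suc)
  then show "entry (mat 1 \<otimes> 1) s t = entry 1 s t"
    by (simp add: tensor.rep_eq one_uhf.rep_eq mat_def)
qed

lemma tensor_add_left: "(a + b) \<otimes> x = a \<otimes> x + b \<otimes> x"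
  by (rule uhf_eqI) (simp add: tensor.rep_eq plus_uhf.rep_eq algebra_simps)

lemma tensor_0_left: "0 \<otimes> x = 0"
  by (rule uhf_eqI) (simp add: tensor.rep_eq zero_uhf.rep_eq)

lemma tensor_0_right: "a \<otimes> 0 = 0"
  by (rule uhf_eqI) (simp add: tensor.rep_eq zero_uhf.rep_eq)

lemma tensor_add_right: "a \<otimes> (x + y) = a \<otimes> x + a \<otimes> y"
  by (rule uhf_eqI) (simp add: tensor.rep_eq plus_uhf.rep_eq algebra_simps)

lemma tensor_sum_right: "a \<otimes> (\<Sum>i\<in>I. f i) = (\<Sum>i\<in>I. a \<otimes> f i)"
  by (induction I rule: infinite_finite_induct) (simp_all add: tensor_0_right tensor_add_right)

lemma tensor_one_inject:
  assumes "a \<otimes> 1 = b \<otimes> 1"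
  shows "a = b"
proof -
  have "a $ i $ j = b $ i $ j" for i j
    using arg_cong [OF assms, of "\<lambda>x. entry x (case_nat i undefined) (case_nat j undefined)"]
    by (simp add: tensor.rep_eq one_uhf.rep_eq comp_def)
  then show ?thesis by (simp add: vec_eq_iff)
qed

lemma star_one: "star 1 = 1"
  by (rule uhf_eqI) (auto simp: star.rep_eq one_uhf.rep_eq)

lemma star_add: "star (x + y) = star x + star y"
  by (rule uhf_eqI) (simp add: star.rep_eq plus_uhf.rep_eq)

lemma star_0: "star 0 = 0"
  by (rule uhf_eqI) (simp add: star.rep_eq zero_uhf.rep_eq)

lemma star_sum: "star (\<Sum>i\<in>I. f i) = (\<Sum>i\<in>I. star (f i))"
  by (induction I rule: infinite_finite_induct) (simp_all add: star_0 star_add)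

lemma ntrace_0: "ntrace 0 = 0"
  using ntrace_add [of 0 0] by simp

lemma ntrace_sum: "ntrace (\<Sum>i\<in>I. f i) = (\<Sum>i\<in>I. ntrace (f i))"
  by (induction I rule: infinite_finite_induct) (simp_all add: ntrace_0 ntrace_add)

lemma entry_sum: "entry (\<Sum>i\<in>I. f i) s t = (\<Sum>i\<in>I. entry (f i) s t)"
  by (induction I rule: infinite_finite_induct) (simp_all add: zero_uhf.rep_eq plus_uhf.rep_eq)

lemma ntrace_commute: "ntrace (x * y) = ntrace (y * x)"
proof -
  obtain k where k: "x \<in> tensor_power k" "y \<in> tensor_power k" by (rule tensor_power_common)
  let ?W = "tail_class k undefined"
  have "(\<Sum>s\<in>?W. entry (x * y) s s) = (\<Sum>s\<in>?W. \<Sum>r\<in>?W. entry x s r * entry y r s)"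
    by (intro sum.cong) (simp_all add: entry_mult [OF k(1)] tail_class_eq)
  also have "\<dots> = (\<Sum>r\<in>?W. \<Sum>s\<in>?W. entry x s r * entry y r s)"
    by (rule sum.swap)
  also have "\<dots> = (\<Sum>s\<in>?W. entry (y * x) s s)"
    by (intro sum.cong) (simp_all add: entry_mult [OF k(2)] tail_class_eq mult.commute)
  finally show ?thesis
    by (simp add: ntrace_eq [OF tensor_power_mult, where ?s0.0 = undefined, OF k]
        ntrace_eq [OF tensor_power_mult, where ?s0.0 = undefined, OF k(2,1)])
qed

lemma ntrace_tensor:
  fixes a :: "complex^'n^'n"
  shows "ntrace (a \<otimes> x) = trace a / of_nat CARD('n) * ntrace x"
proof -
  obtain k where k: "x \<in> tensor_power k" using tensor_power_ex by blast
  show ?thesis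
    unfolding ntrace_eq [OF tensor_in_tensor_power [OF k], where ?s0.0 = undefined]
      ntrace_eq [OF k, of "undefined \<circ> Suc"] tensor.rep_eq
    using sum_tail_class_head [of "\<lambda>c q. a $ c $ c * entry x q q" k undefined]
    by (simp add: trace_def sum_product)
qed

text \<open>Inductions over tensor powers peel off the first factor, because the words \<open>u_odd\<close> grow by
  shifting.\<close>

lemma tensor_power_Suc_decomp:
  fixes x :: "'n::finite uhf"
  assumes "x \<in> tensor_power (Suc k)"
  obtains y where "\<And>a b. y a b \<in> tensor_power k"
    "x = (\<Sum>a\<in>UNIV. \<Sum>b\<in>UNIV. matrix_unit a b \<otimes> y a b)"
proof -
  have x: "entry x \<in> kernels (Suc k)" using assms by (simp add: tensor_power_def)
  define y where "y a b = Abs_uhf (\<lambda>s t. entry x (case_nat a s) (case_nat b t))" for a b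
  have ker: "(\<lambda>s t. entry x (case_nat a s) (case_nat b t)) \<in> kernels k" for a b
  proof (rule kernelsI)
    fix s t :: "nat \<Rightarrow> 'n" assume "t \<notin> tail_class k s"
    then have "case_nat b t \<notin> tail_class (Suc k) (case_nat a s)"
      by (force simp: tail_class_def)
    then show "entry x (case_nat a s) (case_nat b t) = 0" by (rule kernels_zero [OF x])
  next
    fix s t s' t' :: "nat \<Rightarrow> 'n"
    assume t: "t \<in> tail_class k s" "t' \<in> tail_class k s'"
      and "\<And>j. j < k \<Longrightarrow> s' j = s j" "\<And>j. j < k \<Longrightarrow> t' j = t j"
    then show "entry x (case_nat a s') (case_nat b t') = entry x (case_nat a s) (case_nat b t)"
      by (intro kernels_cong [OF x]) (auto simp: tail_class_def split: nat.split)
  qed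
  then have y: "entry (y a b) = (\<lambda>s t. entry x (case_nat a s) (case_nat b t))" for a b
    unfolding y_def by (intro Abs_uhf_inverse) blast
  have "y a b \<in> tensor_power k" for a b
    by (simp add: tensor_power_def y ker)
  moreover have "x = (\<Sum>a\<in>UNIV. \<Sum>b\<in>UNIV. matrix_unit a b \<otimes> y a b)"
  proof (rule uhf_eqI)
    fix s t :: "nat \<Rightarrow> 'n"
    have cn: "case_nat (s 0) (s \<circ> Suc) = s" for s :: "nat \<Rightarrow> 'n"
      by (auto simp: fun_eq_iff split: nat.split)
    have "entry (\<Sum>a\<in>UNIV. \<Sum>b\<in>UNIV. matrix_unit a b \<otimes> y a b) s t =
        (\<Sum>a\<in>UNIV. \<Sum>b\<in>UNIV. if b = t 0 then if a = s 0 then entry x s t else 0 else 0)"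
      unfolding entry_sum
      by (intro sum.cong refl) (auto simp: tensor.rep_eq matrix_unit_def y cn)
    then show "entry x s t = entry (\<Sum>a\<in>UNIV. \<Sum>b\<in>UNIV. matrix_unit a b \<otimes> y a b) s t"
      by simp
  qed
  ultimately show ?thesis by (rule that)
qed

lemma tensor_power_0: "x \<in> tensor_power 0 \<Longrightarrow> \<exists>c. x = c *\<^sub>C 1"
proof -
  assume "x \<in> tensor_power 0"
  then have x: "entry x \<in> kernels 0" by (simp add: tensor_power_def)
  have "x = entry x undefined undefined *\<^sub>C 1"
  proof (rule uhf_eqI)
    fix s t :: "nat \<Rightarrow> 'a"
    show "entry x s t = entry (entry x undefined undefined *\<^sub>C 1) s t"
      using kernels_zero [OF x, of t s] kernels_cong [OF x, of undefined undefined s s]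
      by (auto simp: scaleC_uhf.rep_eq one_uhf.rep_eq)
  qed
  then show ?thesis by blast
qed

section \<open>Maximal abelian subalgebras of the matrix algebra\<close>

definition diag :: "('n \<Rightarrow> complex) \<Rightarrow> complex^'n^'n" where
  "diag c = (\<chi> i j. if i = j then c i else 0)"

text \<open>As \<open>c\<close> varies, \<open>masa u c\<close> runs through the maximal abelian algebra \<open>u \<Delta> u\<^sup>*\<close> of a unitary \<open>u\<close>.\<close>

definition masa :: "complex^'n^'n \<Rightarrow> ('n::finite \<Rightarrow> complex) \<Rightarrow> complex^'n^'n" where
  "masa u c = u ** diag c ** dagger u"

lemma dagger_diag: "dagger (diag c) = diag (\<lambda>i. cnj (c i))"
  by (auto simp: dagger_def diag_def vec_eq_iff)

lemma dagger_one: "dagger (mat 1) = mat 1"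
  by (auto simp: dagger_def mat_def vec_eq_iff)

lemma diag_one: "diag (\<lambda>_. 1) = mat 1"
  by (simp add: diag_def mat_def)

lemma dagger_mult: "dagger (a ** b) = dagger b ** dagger a"
  by (simp add: dagger_def matrix_matrix_mult_def vec_eq_iff mult.commute)

lemma dagger_dagger [simp]: "dagger (dagger a) = a"
  by (simp add: dagger_def vec_eq_iff)

lemma diag_mult: "diag c ** diag d = diag (\<lambda>i. c i * d i)"
  by (simp add: diag_def matrix_matrix_mult_def vec_eq_iff mult_delta_left mult_delta_right)

lemma diag_mult_entry: "(diag c ** a) $ i $ j = c i * a $ i $ j"
  by (simp add: diag_def matrix_matrix_mult_def mult_delta_left mult_delta_right)

lemma mult_diag_entry: "(a ** diag c) $ i $ j = a $ i $ j * c j"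
  by (simp add: diag_def matrix_matrix_mult_def mult_delta_left mult_delta_right)

lemma matrix_unit_diag: "matrix_unit i i = diag (\<lambda>k. of_bool (k = i))"
  by (auto simp: matrix_unit_def diag_def vec_eq_iff)

lemma dagger_matrix_unit: "dagger (matrix_unit i j) = matrix_unit j i"
  by (auto simp: matrix_unit_def dagger_def vec_eq_iff)

lemma matrix_unit_mult_diag:
  "matrix_unit i i ** matrix_unit j j = (if i = j then matrix_unit i i else 0)"
  by (simp add: vec_eq_iff matrix_unit_diag [of i] diag_mult_entry) (simp add: matrix_unit_def)

lemma hadamard_dagger:
  assumes "hadamard_unitary v"
  shows "v ** dagger v = mat 1" "dagger v ** v = mat 1"
  using assms by (simp_all add: hadamard_unitary_def unitary_matrix_def dagger_def Let_def)

lemma hadamard_cmod: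
  fixes v :: "complex^'n^'n"
  assumes "hadamard_unitary v"
  shows "v $ i $ j * cnj (v $ i $ j) = 1 / of_nat CARD('n)"
proof -
  have "v $ i $ j * cnj (v $ i $ j) = of_real ((cmod (v $ i $ j))\<^sup>2)"
    by (rule complex_norm_square [symmetric])
  also have "\<dots> = of_real (1 / real CARD('n))"
    using assms by (simp add: hadamard_unitary_def power_divide)
  finally show ?thesis by simp
qed

text \<open>The trace-preserving conditional expectation of the matrix algebra onto \<open>u \<Delta> u\<^sup>*\<close>, for \<open>u\<close>
  unitary: write \<open>x\<close> in the basis of the columns of \<open>u\<close> and delete the entries off the diagonal.\<close>

definition masa_expectation :: "complex^'n^'n \<Rightarrow> complex^'n^'n \<Rightarrow> complex^'n^'n" where
  "masa_expectation u x = masa u (\<lambda>i. (dagger u ** x ** u) $ i $ i)"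

lemma dagger_masa: "dagger (masa u c) = masa u (\<lambda>i. cnj (c i))"
  by (simp add: masa_def dagger_mult dagger_diag matrix_mul_assoc)

lemma conj_masa:
  assumes "dagger u ** u = mat 1"
  shows "dagger u ** masa u c ** u = diag c"
  unfolding masa_def
  by (simp add: matrix_mul_assoc assms) (simp add: matrix_mul_assoc [symmetric] assms)

lemma masa_mult: "dagger u ** u = mat 1 \<Longrightarrow> masa u c ** masa u d = masa u (\<lambda>i. c i * d i)"
proof -
  assume u: "dagger u ** u = mat 1"
  have "masa u c ** masa u d = u ** diag c ** (dagger u ** u) ** diag d ** dagger u"
    by (simp only: masa_def matrix_mul_assoc)
  also have "\<dots> = u ** (diag c ** diag d) ** dagger u"
    unfolding u by (simp add: matrix_mul_assoc)
  finally show ?thesis by (simp add: masa_def diag_mult)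
qed

lemma masa_one: "u ** dagger u = mat 1 \<Longrightarrow> masa u (\<lambda>_. 1) = mat 1"
  by (simp add: masa_def diag_one)

lemma conj_diag_diagonal:
  fixes g :: "complex^'n^'n"
  shows "(dagger g ** diag c ** g) $ k $ k = (\<Sum>l\<in>UNIV. c l * of_real ((cmod (g $ l $ k))\<^sup>2))"
  unfolding matrix_matrix_mult_def [of "dagger g ** diag c"] complex_norm_square
  by (simp add: mult_diag_entry dagger_def mult_ac)

text \<open>The expectation of a diagonal matrix onto \<open>v \<Delta> v\<^sup>*\<close> is a scalar, because the entries of \<open>v\<close> have
  constant modulus: \<open>\<Delta>\<close> and \<open>v \<Delta> v\<^sup>*\<close> are orthogonal.\<close>

lemma hadamard_conj_diag_entry:
  fixes v :: "complex^'n^'n"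
  assumes "hadamard_unitary v"
  shows "(dagger v ** diag c ** v) $ j $ j = (\<Sum>k\<in>UNIV. c k) / of_nat CARD('n)"
proof -
  have "(dagger v ** diag c ** v) $ j $ j = (\<Sum>k\<in>UNIV. c k * (v $ k $ j * cnj (v $ k $ j)))"
    by (subst matrix_matrix_mult_def) (simp add: mult_diag_entry dagger_def mult_ac)
  then show ?thesis
    by (simp add: hadamard_cmod [OF assms] sum_divide_distrib)
qed

section \<open>Spin model algebras seen from the first tensor factor\<close>

lemma shift_prod_list: "mat 1 \<otimes> prod_list xs = prod_list (map (\<lambda>x. mat 1 \<otimes> x) xs)"
proof (induction xs)
  case (Cons x xs)
  then show ?case by (simp add: tensor_mult flip: Cons)
qed (simp add: tensor_one)

lemma u_odd_0: "u_odd u 0 = 1"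
  by (simp add: u_odd_def)

lemma u_odd_Suc: "u_odd u (Suc k) = u1_op u * (mat 1 \<otimes> u_odd u k)"
  unfolding u_odd_def
  by (simp add: upt_conv_Cons map_Suc_upt [symmetric] shift_prod_list comp_def del: upt_Suc)

text \<open>The element \<open>D_op v\<close> is block diagonal with respect to the second tensor factor, and these
  diagonal matrices are its blocks.\<close>

definition D_block :: "complex^'n^'n \<Rightarrow> 'n \<Rightarrow> complex^'n^'n" where
  "D_block v i = diag (\<lambda>j. of_real (sqrt (real CARD('n))) * cnj (v $ i $ j))"

lemma D_op_eq:
  "D_op u = (\<Sum>i\<in>UNIV. D_block u i \<otimes> matrix_unit i i \<otimes> 1)"
  for u :: "complex^'n^'n"
proof (rule uhf_eqI)
  fix s t :: "nat \<Rightarrow> 'n"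
  let ?r = "complex_of_real (sqrt (real CARD('n)))"
  have *: "?r * (\<Sum>j\<in>UNIV. cnj (u $ i $ j) * (matrix_unit j j $ s 0 $ t 0 * e)) =
      D_block u i $ s 0 $ t 0 * e" for i e
  proof (cases "s 0 = t 0")
    case False
    then have "matrix_unit j j $ s 0 $ t 0 = 0" for j
      by (auto simp: matrix_unit_def)
    with False show ?thesis by (simp add: D_block_def diag_def)
  qed (simp add: D_block_def diag_def matrix_unit_def mult_delta_left mult_delta_right)
  show "entry (D_op u) s t =
      entry (\<Sum>i\<in>UNIV. D_block u i \<otimes> matrix_unit i i \<otimes> 1) s t"
    by (simp add: D_op_def entry_sum scaleC_uhf.rep_eq tensor.rep_eq sum_distrib_left flip: *)
qed

lemma star_D_op: "star (D_op u) = (\<Sum>i\<in>UNIV. dagger (D_block u i) \<otimes> matrix_unit i i \<otimes> 1)"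
  unfolding D_op_eq star_sum star_tensor star_one by (simp add: dagger_matrix_unit)

lemma tensor_scalar: "diag (\<lambda>_. c) \<otimes> x = c *\<^sub>C (mat 1 \<otimes> x)"
  by (rule uhf_eqI) (simp add: scaleC_uhf.rep_eq tensor.rep_eq diag_def mat_def)

text \<open>The reason for the whole reduction to matrices. Conjugation by \<open>u\<^sub>1 = (v \<otimes> 1) D\<close> turns a matrix
  unit \<open>E\<^bsub>ab\<^esub> \<otimes> t\<close> with \<open>t\<close> in the previous stage into a sum over the blocks \<open>i\<close>, weighted by
  \<open>\<tau>(E\<^bsub>ii\<^esub> t)\<close>. By induction \<open>t\<close> is orthogonal to all diagonal matrices of trace 0, so the weight
  does not depend on \<open>i\<close>; summing over \<open>i\<close> and using that the columns of \<open>v\<close> are orthonormal leaves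
  only \<open>a = b\<close>. Thus only the diagonal of \<open>v\<^sup>* z v\<close> contributes to the trace.\<close>

lemma spin_word_orthogonal:
  fixes v z :: "complex^'n^'n"
  assumes v: "hadamard_unitary v" and x: "x \<in> tensor_power k"
    and z: "\<And>i. (dagger v ** z ** v) $ i $ i = 0"
  shows "ntrace ((z \<otimes> 1) * (u_odd v k * x * star (u_odd v k))) = 0"
  using x z
proof (induction k arbitrary: x z)
  case 0
  obtain c where x: "x = c *\<^sub>C 1" using tensor_power_0 [OF 0(1)] by blast
  have "trace z = trace (dagger v ** z ** v)"
    by (subst trace_mul_sym) (simp add: matrix_mul_assoc hadamard_dagger [OF v])
  also have "\<dots> = 0" by (simp add: trace_def 0(2))
  finally show ?case
    by (simp add: x u_odd_0 star_one mult_scaleC ntrace_scaleC ntrace_tensor)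
next
  case (Suc k)
  let ?n = "of_nat CARD('n) :: complex"
  let ?d = "D_block v"
  define y where "y = dagger v ** z ** v"
  obtain w where w: "\<And>a b. w a b \<in> tensor_power k"
    and x: "x = (\<Sum>a\<in>UNIV. \<Sum>b\<in>UNIV. matrix_unit a b \<otimes> w a b)"
    by (rule tensor_power_Suc_decomp [OF Suc.prems(1)]) (rule that)
  define t where "t a b = u_odd v k * w a b * star (u_odd v k)" for a b
  \<comment> \<open>the diagonal matrix \<open>E\<^bsub>ii\<^esub> - 1/n\<close> has expectation 0 onto \<open>v \<Delta> v\<^sup>*\<close>, so the induction
    hypothesis applies to it\<close>
  have ortho: "ntrace ((matrix_unit i i \<otimes> 1) * t a b) = ntrace (t a b) / ?n" for i a b
  proof -
    define m where "m = diag (\<lambda>k. of_bool (k = i) - 1 / ?n)"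
    have "ntrace ((m \<otimes> 1) * t a b) = 0"
      unfolding t_def
    proof (rule Suc.IH [OF w])
      fix j
      show "(dagger v ** m ** v) $ j $ j = 0"
        unfolding m_def hadamard_conj_diag_entry [OF v] by (simp add: sum_subtractf of_bool_def)
    qed
    moreover have "matrix_unit i i = m + diag (\<lambda>_. 1 / ?n)"
      by (auto simp: m_def matrix_unit_diag diag_def vec_eq_iff)
    ultimately show ?thesis
      by (simp add: tensor_add_left tensor_scalar tensor_one distrib_right mult_scaleC ntrace_add ntrace_scaleC)
  qed
  have "(mat 1 \<otimes> u_odd v k) * x * star (mat 1 \<otimes> u_odd v k) =
      (\<Sum>a\<in>UNIV. \<Sum>b\<in>UNIV. matrix_unit a b \<otimes> t a b)"
    by (simp add: x sum_distrib_left sum_distrib_right star_tensor tensor_mult t_def dagger_one)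
  moreover have "u_odd v (Suc k) * x * star (u_odd v (Suc k)) = (v \<otimes> 1) *
      (D_op v * ((mat 1 \<otimes> u_odd v k) * x * star (mat 1 \<otimes> u_odd v k)) * star (D_op v)) * (dagger v \<otimes> 1)"
    by (simp add: u_odd_Suc u1_op_def star_mult star_tensor [of v] star_one mult.assoc)
  ultimately have eq: "u_odd v (Suc k) * x * star (u_odd v (Suc k)) =
      (v \<otimes> 1) * (D_op v * (\<Sum>a\<in>UNIV. \<Sum>b\<in>UNIV. matrix_unit a b \<otimes> t a b) * star (D_op v)) * (dagger v \<otimes> 1)"
    by simp
  have cyc: "ntrace ((z \<otimes> 1) * ((v \<otimes> 1) * s * (dagger v \<otimes> 1))) = ntrace ((y \<otimes> 1) * s)" for s
  proof -
    have "ntrace ((z \<otimes> 1) * ((v \<otimes> 1) * s * (dagger v \<otimes> 1))) =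
        ntrace ((((z \<otimes> 1) * (v \<otimes> 1)) * s) * (dagger v \<otimes> 1))"
      by (simp add: mult.assoc)
    also have "\<dots> = ntrace ((dagger v \<otimes> 1) * (((z \<otimes> 1) * (v \<otimes> 1)) * s))"
      by (rule ntrace_commute)
    also have "\<dots> = ntrace ((dagger v \<otimes> 1) * ((z \<otimes> 1) * (v \<otimes> 1)) * s)"
      by (simp only: mult.assoc)
    finally show ?thesis
      by (simp add: y_def tensor_mult matrix_mul_assoc)
  qed
  \<comment> \<open>tracing out moves \<open>E\<^bsub>jj\<^esub>\<close> next to \<open>E\<^bsub>ii\<^esub>\<close>, which kills the mixed blocks\<close>
  have slide: "ntrace ((y ** (?d i ** matrix_unit a b ** dagger (?d j))) \<otimes>
      ((matrix_unit i i \<otimes> 1) * t a b * (matrix_unit j j \<otimes> 1))) =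
      (if i = j then y $ b $ a * (cnj (v $ i $ a) * v $ i $ b) * ntrace (t a b) / ?n else 0)" for a b i j
  proof -
    have "ntrace ((matrix_unit i i \<otimes> 1) * t a b * (matrix_unit j j \<otimes> 1)) =
        ntrace ((matrix_unit j j \<otimes> 1) * ((matrix_unit i i \<otimes> 1) * t a b))"
      by (rule ntrace_commute)
    also have "\<dots> = (if i = j then ntrace (t a b) / ?n else 0)"
    proof (cases "i = j")
      case True
      then show ?thesis
        by (simp add: mult.assoc [symmetric] tensor_mult matrix_unit_mult_diag ortho)
    next
      case False
      then show ?thesis
        by (simp add: mult.assoc [symmetric] tensor_mult matrix_unit_mult_diag tensor_0_left ntrace_0)
    qed
    finally have 1: "ntrace ((matrix_unit i i \<otimes> 1) * t a b * (matrix_unit j j \<otimes> 1)) =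
      (if i = j then ntrace (t a b) / ?n else 0)" .
    have n: "complex_of_real (sqrt (real CARD('n))) * complex_of_real (sqrt (real CARD('n))) = ?n"
      by (simp flip: of_real_mult)
    have "(?d i ** matrix_unit a b ** dagger (?d i)) $ p $ q =
        (if p = a \<and> q = b then ?n * (cnj (v $ i $ a) * v $ i $ b) else 0)" for p q
      by (simp add: D_block_def dagger_diag mult_diag_entry diag_mult_entry matrix_unit_def flip: n)
    then have "(y ** (?d i ** matrix_unit a b ** dagger (?d i))) $ q $ q =
        (if q = b then y $ b $ a * (?n * (cnj (v $ i $ a) * v $ i $ b)) else 0)" for q
      by (cases "q = b") (simp_all add: matrix_matrix_mult_def [of y] mult_delta_right)
    then have "trace (y ** (?d i ** matrix_unit a b ** dagger (?d i))) = ?n * (y $ b $ a * (cnj (v $ i $ a) * v $ i $ b))"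
      by (simp add: trace_def)
    with 1 show ?thesis
      by (cases "i = j") (simp_all add: ntrace_tensor)
  qed
  have cols: "(\<Sum>i\<in>UNIV. cnj (v $ i $ a) * v $ i $ b) = of_bool (a = b)" for a b
    using arg_cong [OF hadamard_dagger(2) [OF v], of "\<lambda>m. m $ a $ b"]
    by (simp add: matrix_matrix_mult_def dagger_def mat_def)
  have "ntrace ((z \<otimes> 1) * (u_odd v (Suc k) * x * star (u_odd v (Suc k)))) =
      ntrace ((y \<otimes> 1) * (D_op v * (\<Sum>a\<in>UNIV. \<Sum>b\<in>UNIV. matrix_unit a b \<otimes> t a b) * star (D_op v)))"
    unfolding eq by (rule cyc)
  also have "\<dots> = (\<Sum>a\<in>UNIV. \<Sum>b\<in>UNIV. \<Sum>i\<in>UNIV. \<Sum>j\<in>UNIV.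
      ntrace ((y ** (?d i ** matrix_unit a b ** dagger (?d j))) \<otimes>
        ((matrix_unit i i \<otimes> 1) * t a b * (matrix_unit j j \<otimes> 1))))"
  proof -
    have "D_op v * (matrix_unit a b \<otimes> t a b) * star (D_op v) =
      (\<Sum>i\<in>UNIV. \<Sum>j\<in>UNIV. (?d i ** matrix_unit a b ** dagger (?d j)) \<otimes>
        ((matrix_unit i i \<otimes> 1) * t a b * (matrix_unit j j \<otimes> 1)))" for a b
      unfolding star_D_op unfolding D_op_eq
      by (subst sum.swap) (simp add: sum_distrib_left sum_distrib_right tensor_mult)
    then show ?thesis
      by (simp add: sum_distrib_left sum_distrib_right tensor_mult ntrace_sum)
  qed
  also have "\<dots> = (\<Sum>a\<in>UNIV. \<Sum>b\<in>UNIV. y $ b $ a * ntrace (t a b) / ?n * (\<Sum>i\<in>UNIV. cnj (v $ i $ a) * v $ i $ b))"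
    unfolding slide by (simp add: sum_distrib_left mult_ac)
  also have "\<dots> = 0"
    unfolding cols by (intro sum.neutral ballI) (auto simp: y_def Suc.prems(2))
  finally show ?case .
qed

text \<open>Diagonal matrices commute with the unitary \<open>D_op v\<close>, so at the first stage conjugation by
  \<open>u_odd v 1\<close> acts on them like conjugation by \<open>v\<close>.\<close>

lemma masa_in_spin_algebra:
  fixes v :: "complex^'n^'n"
  assumes v: "hadamard_unitary v"
  shows "masa v c \<otimes> 1 = u_odd v 1 * (diag c \<otimes> 1) * star (u_odd v 1)"
proof -
  let ?d = "D_block v"
  have n: "complex_of_real (sqrt (real CARD('n))) * complex_of_real (sqrt (real CARD('n))) = of_nat CARD('n)"
    by (simp flip: of_real_mult)
  \<comment> \<open>the blocks are unitary since \<open>|v\<^bsub>ij\<^esub>|\<^sup>2 = 1/n\<close>\<close>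
  have dd: "?d i ** diag c ** dagger (?d i) = diag c" for i
  proof -
    have *: "of_real (sqrt (real CARD('n))) * cnj (v $ i $ j) * c j *
        (of_real (sqrt (real CARD('n))) * v $ i $ j) = c j" for j
    proof -
      have "of_real (sqrt (real CARD('n))) * cnj (v $ i $ j) * c j *
        (of_real (sqrt (real CARD('n))) * v $ i $ j) = 
        (complex_of_real (sqrt (real CARD('n))) * of_real (sqrt (real CARD('n)))) * (v $ i $ j * cnj (v $ i $ j)) * c j"
        by (simp only: mult_ac)
      then show ?thesis unfolding n hadamard_cmod [OF v] by simp
    qed
    show ?thesis
      unfolding D_block_def dagger_diag diag_mult
      by (simp only: * complex_cnj_mult complex_cnj_complex_of_real complex_cnj_cnj)
  qed
  have "D_op v * (diag c \<otimes> 1) * star (D_op v) =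
      (\<Sum>i\<in>UNIV. \<Sum>j\<in>UNIV. (?d i ** diag c ** dagger (?d j)) \<otimes> (matrix_unit i i ** matrix_unit j j) \<otimes> 1)"
    unfolding star_D_op unfolding D_op_eq
    by (subst sum.swap) (simp add: sum_distrib_left sum_distrib_right tensor_mult)
  also have "\<dots> = (\<Sum>i\<in>UNIV. \<Sum>j\<in>UNIV. if i = j then diag c \<otimes> matrix_unit i i \<otimes> 1 else 0)"
    by (intro sum.cong refl) (simp add: matrix_unit_mult_diag dd tensor_0_left tensor_0_right)
  also have "\<dots> = diag c \<otimes> (\<Sum>i\<in>UNIV. matrix_unit i i \<otimes> 1)"
    by (simp add: tensor_sum_right)
  also have "(\<Sum>i\<in>UNIV. matrix_unit i i \<otimes> 1) = mat 1 \<otimes> (1 :: 'n uhf)"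
  proof (rule uhf_eqI)
    fix s t :: "nat \<Rightarrow> 'n"
    have "matrix_unit i i $ s 0 $ t 0 = of_bool (i = s 0) * of_bool (s 0 = t 0)" for i
      by (auto simp: matrix_unit_def)
    then show "entry (\<Sum>i\<in>UNIV. matrix_unit i i \<otimes> 1) s t = entry (mat 1 \<otimes> 1) s t"
      by (simp add: entry_sum tensor.rep_eq mat_def of_bool_def mult_delta_left)
  qed
  finally have "D_op v * (diag c \<otimes> 1) * star (D_op v) = diag c \<otimes> 1"
    by (simp add: tensor_one)
  then have "(v \<otimes> 1) * (D_op v * (diag c \<otimes> 1) * star (D_op v)) * (dagger v \<otimes> 1) = masa v c \<otimes> 1"
    by (simp add: tensor_mult masa_def)
  then show ?thesis
    by (simp add: u_odd_Suc u_odd_0 tensor_one u1_op_def star_mult star_tensor star_one mult.assoc)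
qed

section \<open>Matrix coefficients and the GNS representation\<close>

text \<open>Matrix coefficients are continuous in the weak operator topology, so linear relations between
  them pass from a generating algebra to its closure.\<close>

lemma wot_closure_coefficient_eq:
  assumes T: "T \<in> weak_operator_topology closure_of M"
    and eq: "\<And>S. S \<in> M \<Longrightarrow> cinner (blinfun_apply S \<xi>) \<eta> = cinner (blinfun_apply S \<xi>') \<eta>'"
  shows "cinner (blinfun_apply T \<xi>) \<eta> = cinner (blinfun_apply T \<xi>') \<eta>'"
proof -
  have cont: "continuous_map weak_operator_topology euclidean (\<lambda>T. cinner (blinfun_apply T a) b)"
    for a b :: 'a
  proof -
    have "continuous_map euclidean euclidean (\<lambda>F :: 'a \<times> 'a \<Rightarrow> complex. F (a, b))"
      by simp
    from continuous_map_pullback [OF this, of UNIV "\<lambda>T (x, y). cinner (blinfun_apply T x) y"]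
    show ?thesis by (simp add: weak_operator_topology_def comp_def)
  qed
  show ?thesis
    by (rule forall_in_closure_of_eq [OF T _ cont cont eq]) simp_all
qed

lemma wot_closure_subset: "S \<in> M \<Longrightarrow> S \<in> weak_operator_topology closure_of M"
  using closure_of_subset [of M weak_operator_topology]
  by (auto simp: weak_operator_topology_def topspace_pullback_topology)

lemma cinner_zero_left: "cinner 0 y = 0"
  using cinner_add_left [of 0 0 y] by simp

lemma gns_eq_0I:
  fixes h :: "'a::complex_inner hcompletion"
  assumes "\<And>w. cinner h (embed w) = 0"
  shows "h = 0"
proof -
  have "h \<in> closure (range embed)" by (simp add: closure_range_embed)
  moreover have "continuous_on (closure (range embed)) (\<lambda>k. inner h k)"
    by (intro continuous_intros)
  moreover have "inner h k = 0" if "k \<in> range embed" for k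
    using that assms by (auto simp flip: Re_cinner)
  ultimately have "inner h h = 0" using continuous_constant_on_closure by blast
  then show ?thesis by simp
qed

lemma gns_op_eqI:
  fixes S T :: "'n::finite gns \<Rightarrow>\<^sub>L 'n gns"
  assumes "\<And>x. blinfun_apply S (embed x) = blinfun_apply T (embed x)"
  shows "S = T"
proof (rule blinfun_eqI)
  fix h :: "'n gns"
  have "h \<in> closure (range embed)" by (simp add: closure_range_embed)
  moreover have "continuous_on (closure (range embed)) (\<lambda>h. (S - T) h)"
    by (rule linear_continuous_on [OF blinfun.bounded_linear_right])
  moreover have "(S - T) h = 0" if "h \<in> range embed" for h
    using that assms by (auto simp: blinfun.diff_left)
  ultimately have "(S - T) h = 0" using continuous_constant_on_closure by blast
  then show "S h = T h" by (simp add: blinfun.diff_left)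
qed

lemma embed_add: "embed (x + y) = embed x + embed y"
  by transfer (rule riesz_add)

lemma embed_0: "embed 0 = 0"
  using embed_add [of 0 0] by simp

lemma norm_embed: "norm (embed x) = norm x"
  by transfer (rule norm_riesz)

lemma gns_rep_add: "gns_rep (a + b) = gns_rep a + gns_rep b"
  by (rule gns_op_eqI) (simp add: gns_rep_embed blinfun.add_left distrib_right embed_add)

lemma gns_rep_mult: "gns_rep (a * b) = gns_rep a o\<^sub>L gns_rep b"
  by (rule gns_op_eqI) (simp add: gns_rep_embed mult.assoc)

lemma gns_rep_one: "gns_rep 1 = id_blinfun"
  by (rule gns_op_eqI) (simp add: gns_rep_embed)

lemma embed_inject: "embed x = embed y \<Longrightarrow> x = y"
  using embed_add [of "x - y" y] norm_embed [of "x - y"] by simp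

lemma gns_rep_inject: "gns_rep a = gns_rep b \<Longrightarrow> a = b"
  using embed_inject by (metis gns_rep_embed mult_1_right)

lemma cinner_gns_rep: "cinner (gns_rep a (embed x)) (embed y) = ntrace (star y * (a * x))"
  by (simp add: gns_rep_embed cinner_embed cinner_uhf_def)

lemma vector_trace_gns_rep: "vector_trace (gns_rep a) = ntrace a"
  by (simp add: vector_trace_def trace_vector_def cinner_gns_rep star_one)

lemma norm_isometry:
  fixes a :: "'n::finite uhf"
  assumes "star a * a = 1"
  shows "norm (a * x) = norm x"
proof -
  have "star (a * x) * (a * x) = star x * (star a * a) * x"
    by (simp only: star_mult mult.assoc)
  then have "cinner (a * x) (a * x) = cinner x x"
    by (simp add: cinner_uhf_def assms)
  then have "(norm (a * x))\<^sup>2 = (norm x)\<^sup>2"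
    by (simp only: cinner_self of_real_eq_iff)
  then show ?thesis by simp
qed

lemma norm_gns_rep_isometry:
  assumes "star a * a = 1"
  shows "norm (gns_rep a) \<le> 1"
proof (rule norm_blinfun_bound)
  fix h :: "'a gns"
  have "closed {h. norm (gns_rep a h) \<le> norm h}"
    by (intro closed_Collect_le continuous_intros linear_continuous_on blinfun.bounded_linear_right)
  moreover have "range embed \<subseteq> {h. norm (gns_rep a h) \<le> norm h}"
    by (auto simp: gns_rep_embed norm_embed norm_isometry [OF assms])
  ultimately have "closure (range embed) \<subseteq> {h. norm (gns_rep a h) \<le> norm h}"
    by (rule closure_minimal [rotated])
  then show "norm (gns_rep a h) \<le> 1 * norm h"
    by (auto simp: closure_range_embed)
qed simp

text \<open>The trace property of the cyclic vector, in the form in which it survives weak closure: right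
  multiplication by \<open>y\<close> can be moved to the other side.\<close>

lemma hyperfinite_R_trace:
  fixes V :: "'n::finite gns \<Rightarrow>\<^sub>L 'n gns"
  assumes "V \<in> hyperfinite_R"
  shows "cinner (blinfun_apply V (embed y)) (embed w) = cinner (blinfun_apply V (embed 1)) (embed (w * star y))"
  using assms unfolding hyperfinite_R_def
proof (rule wot_closure_coefficient_eq)
  fix S :: "'n gns \<Rightarrow>\<^sub>L 'n gns" assume "S \<in> gns_rep ` (\<Union>k. tensor_power k)"
  then obtain t where S: "S = gns_rep t" by blast
  show "cinner (blinfun_apply S (embed y)) (embed w) = cinner (blinfun_apply S (embed 1)) (embed (w * star y))"
    using ntrace_commute [of "star w * t" y]
    by (simp add: S cinner_gns_rep star_mult mult.assoc)
qed

text \<open>Since left multiplications commute with right multiplications, an operator killing the trace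
  vector kills a dense subspace.\<close>

lemma hyperfinite_R_separating:
  assumes V: "V \<in> hyperfinite_R" and "blinfun_apply V (embed 1) = 0"
  shows "V = 0"
proof (rule gns_op_eqI)
  fix x
  have "cinner (blinfun_apply V (embed x)) (embed w) = 0" for w
    using hyperfinite_R_trace [OF V, of x w] assms(2) by (simp add: cinner_zero_left)
  then show "blinfun_apply V (embed x) = blinfun_apply 0 (embed x)"
    by (simp add: gns_eq_0I)
qed


section \<open>Conditional expectations onto spin model subfactors\<close>

text \<open>The weakly dense union in the definition of \<open>spin_R\<close>, before it is represented on the GNS space.\<close>

definition spin_algebra :: "complex^'n^'n \<Rightarrow> 'n::finite uhf set" where
  "spin_algebra v = (\<Union>k\<in>{1..}. (\<lambda>x. u_odd v k * x * star (u_odd v k)) ` tensor_power k)"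

lemma spin_R_eq: "spin_R v = weak_operator_topology closure_of (gns_rep ` spin_algebra v)"
  by (simp add: spin_R_def spin_algebra_def)

lemma gns_rep_in_spin_R: "t \<in> spin_algebra v \<Longrightarrow> gns_rep t \<in> spin_R v"
  unfolding spin_R_eq by (intro wot_closure_subset imageI)

lemma gns_rep_in_hyperfinite_R: "gns_rep t \<in> hyperfinite_R"
  unfolding hyperfinite_R_def using tensor_power_ex [of t] by (intro wot_closure_subset) blast

lemma star_spin_algebra: "t \<in> spin_algebra v \<Longrightarrow> star t \<in> spin_algebra v"
  by (auto simp: spin_algebra_def star_mult mult.assoc intro!: bexI imageI tensor_power_star)

lemma spin_algebra_orthogonal:
  assumes "hadamard_unitary v" "\<And>i. (dagger v ** z ** v) $ i $ i = 0" "t \<in> spin_algebra v"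
  shows "ntrace ((z \<otimes> 1) * t) = 0"
proof -
  obtain k x where "x \<in> tensor_power k" "t = u_odd v k * x * star (u_odd v k)"
    using assms(3) by (auto simp: spin_algebra_def)
  then show ?thesis using spin_word_orthogonal [OF assms(1) _ assms(2)] by simp
qed

lemma masa_in_spin_R:
  assumes "hadamard_unitary v"
  shows "gns_rep (masa v c \<otimes> 1) \<in> spin_R v"
  unfolding masa_in_spin_algebra [OF assms]
  by (rule gns_rep_in_spin_R)
    (auto simp: spin_algebra_def intro!: bexI [of _ "1 :: nat"] tensor_in_tensor_power [of _ 0, simplified] one_in_tensor_power)

text \<open>Write \<open>V\<close> for the expectation of \<open>z\<close>. The bimodule property and preservation of the trace give
  \<open>\<tau>(V s) = \<tau>(z s) = 0\<close> for all \<open>s\<close> in the dense algebra, so \<open>V\<close> applied to the trace vector is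
  orthogonal to that algebra. As \<open>V\<close> itself is a weak limit of elements of the algebra, its vector is
  orthogonal to itself, and the trace vector is separating.\<close>

lemma cond_exp_spin_R_eq_0:
  fixes v :: "complex^'n^'n"
  assumes v: "hadamard_unitary v" and sub: "spin_R v \<subseteq> hyperfinite_R"
    and E: "conditional_expectation vector_trace hyperfinite_R (spin_R v) E"
    and z: "\<And>i. (dagger v ** z ** v) $ i $ i = 0"
  shows "E (gns_rep (z \<otimes> 1)) = 0"
proof (rule hyperfinite_R_separating)
  let ?T = "gns_rep (z \<otimes> 1)"
  have V: "E ?T \<in> spin_R v"
    using E gns_rep_in_hyperfinite_R by (auto simp: conditional_expectation_def)
  then show VR: "E ?T \<in> hyperfinite_R" using sub by blast
  have one: "id_blinfun \<in> spin_R v"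
    using masa_in_spin_R [OF v, of "\<lambda>_. 1"]
    by (simp add: masa_def diag_one hadamard_dagger [OF v] tensor_one gns_rep_one)
  have null: "cinner (E ?T (embed 1)) (embed s) = 0" if s: "s \<in> spin_algebra v" for s
  proof -
    let ?S = "gns_rep (star s)"
    have ts: "star s \<in> spin_algebra v" using star_spin_algebra [OF s] .
    have "cinner (E ?T (embed 1)) (embed s) = vector_trace (E ?T o\<^sub>L ?S)"
      using hyperfinite_R_trace [OF VR, of "star s" 1]
      by (simp add: vector_trace_def trace_vector_def gns_rep_embed)
    also have "E ?T o\<^sub>L ?S = E (?T o\<^sub>L ?S)"
    proof -
      have "E (id_blinfun o\<^sub>L ?T o\<^sub>L ?S) = id_blinfun o\<^sub>L E ?T o\<^sub>L ?S"
        using E one gns_rep_in_spin_R [OF ts] gns_rep_in_hyperfinite_R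
        unfolding conditional_expectation_def by blast
      then show ?thesis by (metis blinfun_eqI blinfun_apply_blinfun_compose blinfun_apply_id_blinfun id_apply)
    qed
    also have "vector_trace (E (?T o\<^sub>L ?S)) = vector_trace (?T o\<^sub>L ?S)"
      using E gns_rep_in_hyperfinite_R unfolding conditional_expectation_def gns_rep_mult [symmetric] by blast
    also have "\<dots> = ntrace ((z \<otimes> 1) * star s)"
      by (simp add: vector_trace_gns_rep flip: gns_rep_mult)
    also have "\<dots> = 0" by (rule spin_algebra_orthogonal [OF v z ts])
    finally show ?thesis .
  qed
  \<comment> \<open>the vanishing right-hand side has the shape of a matrix coefficient, as
    \<open>wot_closure_coefficient_eq\<close> requires\<close>
  have "cinner (E ?T (embed 1)) (E ?T (embed 1)) = cinner (E ?T 0) 0"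
    using V unfolding spin_R_eq
  proof (rule wot_closure_coefficient_eq)
    fix S assume "S \<in> gns_rep ` spin_algebra v"
    then show "cinner (S (embed 1)) (E ?T (embed 1)) = cinner (S 0) 0"
      using null by (subst cinner_commute) (auto simp: gns_rep_embed blinfun.zero_right cinner_zero_left)
  qed
  then show "E ?T (embed 1) = 0"
    by (simp add: cinner_self blinfun.zero_right cinner_zero_left)
qed

text \<open>Split \<open>x\<close> into its expectation onto \<open>v \<Delta> v\<^sup>*\<close>, which lies in the subfactor and is fixed, and a
  remainder to which the preceding lemma applies.\<close>

lemma cond_exp_spin_R_matrix:
  fixes v :: "complex^'n^'n"
  assumes v: "hadamard_unitary v" and sub: "spin_R v \<subseteq> hyperfinite_R"
    and E: "conditional_expectation vector_trace hyperfinite_R (spin_R v) E"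
  shows "E (gns_rep (x \<otimes> 1)) = gns_rep (masa_expectation v x \<otimes> 1)"
proof -
  define b where "b = masa_expectation v x"
  have b: "dagger v ** b ** v = diag (\<lambda>i. (dagger v ** x ** v) $ i $ i)"
    unfolding b_def masa_expectation_def by (rule conj_masa [OF hadamard_dagger(2) [OF v]])
  have "dagger v ** ((x - b) + b) ** v = dagger v ** (x - b) ** v + dagger v ** b ** v"
    unfolding matrix_add_ldistrib
    by (simp add: vec_eq_iff matrix_matrix_mult_def [of _ v] sum.distrib distrib_right)
  from arg_cong [OF this, of "\<lambda>m. m $ i $ i" for i] have "(dagger v ** (x - b) ** v) $ i $ i = 0" for i
    by (simp add: b diag_def)
  then have z: "E (gns_rep ((x - b) \<otimes> 1)) = 0" by (rule cond_exp_spin_R_eq_0 [OF v sub E])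
  have "gns_rep (x \<otimes> 1) = gns_rep (b \<otimes> 1) + gns_rep ((x - b) \<otimes> 1)"
    by (simp add: gns_rep_add [symmetric] tensor_add_left [symmetric])
  then have "E (gns_rep (x \<otimes> 1)) = E (gns_rep (b \<otimes> 1)) + E (gns_rep ((x - b) \<otimes> 1))"
    using E gns_rep_in_hyperfinite_R unfolding conditional_expectation_def by metis
  also have "E (gns_rep (b \<otimes> 1)) = gns_rep (b \<otimes> 1)"
    using E masa_in_spin_R [OF v] unfolding conditional_expectation_def b_def masa_expectation_def by blast
  finally have "E (gns_rep (x \<otimes> 1)) = gns_rep (b \<otimes> 1)" by (simp add: z)
  then show ?thesis by (simp only: b_def)
qed

section \<open>Commuting squares and doubly stochastic matrices\<close>

lemma masa_expectations_commute:
  fixes u v :: "complex^'n^'n"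
  assumes u: "hadamard_unitary u" and v: "hadamard_unitary v"
    and sq: "commuting_square vector_trace hyperfinite_R (spin_R u) (spin_R v) N"
  shows "masa_expectation u (masa_expectation v x) =
    masa_expectation v (masa_expectation u x)"
proof -
  obtain E F where sub: "spin_R u \<subseteq> hyperfinite_R" "spin_R v \<subseteq> hyperfinite_R"
    and E: "conditional_expectation vector_trace hyperfinite_R (spin_R u) E"
    and F: "conditional_expectation vector_trace hyperfinite_R (spin_R v) F"
    and comm: "\<And>T. T \<in> hyperfinite_R \<Longrightarrow> E (F T) = F (E T)"
    using sq unfolding commuting_square_def by metis
  have "E (F (gns_rep (x \<otimes> 1))) = F (E (gns_rep (x \<otimes> 1)))"
    by (rule comm [OF gns_rep_in_hyperfinite_R])
  then have "gns_rep (masa_expectation u (masa_expectation v x) \<otimes> 1) =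
    gns_rep (masa_expectation v (masa_expectation u x) \<otimes> 1)"
    by (simp add: cond_exp_spin_R_matrix [OF u sub(1) E] cond_exp_spin_R_matrix [OF v sub(2) F])
  then have "masa_expectation u (masa_expectation v x) \<otimes> 1 =
    masa_expectation v (masa_expectation u x) \<otimes> 1"
    by (rule gns_rep_inject)
  then show ?thesis by (rule tensor_one_inject)
qed

text \<open>Apply the commuting expectations to the minimal projection \<open>p\<^sub>j = masa u e\<close>. With
  \<open>S\<^bsub>jk\<^esub> = |g\<^bsub>jk\<^esub>|\<^sup>2\<close>, its expectation onto \<open>v \<Delta> v\<^sup>*\<close> has coefficients \<open>S\<^bsub>jk\<^esub>\<close>; expecting that once more
  onto \<open>u \<Delta> u\<^sup>*\<close> gives the coefficients \<open>(S S\<^sup>T)\<^bsub>jl\<^esub>\<close>. The two results agree as matrices, which reads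
  \<open>diag (S S\<^sup>T)\<^sub>j g = g diag S\<^sub>j\<close>; compare the entries at \<open>(l, k)\<close>.\<close>

lemma commuting_square_transition:
  fixes u v :: "complex^'n^'n"
  assumes u: "hadamard_unitary u" and v: "hadamard_unitary v"
    and sq: "commuting_square vector_trace hyperfinite_R (spin_R u) (spin_R v) N"
  defines "g \<equiv> dagger u ** v"
  assumes nz: "g $ l $ k \<noteq> 0"
  shows "(cmod (g $ j $ k))\<^sup>2 = (\<Sum>m\<in>UNIV. (cmod (g $ j $ m))\<^sup>2 * (cmod (g $ l $ m))\<^sup>2)"
proof -
  define e where "e = (\<lambda>i. of_bool (i = j) :: complex)"
  define s where "s = (\<lambda>i. complex_of_real ((cmod (g $ j $ i))\<^sup>2))"
  define f where "f = (\<lambda>i. complex_of_real (\<Sum>m\<in>UNIV. (cmod (g $ j $ m))\<^sup>2 * (cmod (g $ i $ m))\<^sup>2))"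
  have vu: "dagger v ** masa u c ** v = dagger g ** diag c ** g" for c
    by (simp add: masa_def g_def dagger_mult matrix_mul_assoc)
  have uv: "dagger u ** masa v c ** u = dagger (dagger g) ** diag c ** dagger g" for c
    by (simp add: masa_def g_def dagger_mult matrix_mul_assoc)
  have 1: "(\<lambda>i. (dagger u ** masa u e ** u) $ i $ i) = e"
    by (simp add: conj_masa [OF hadamard_dagger(2) [OF u]] diag_def)
  have 2: "(\<lambda>i. (dagger v ** masa u e ** v) $ i $ i) = s"
    by (simp only: vu conj_diag_diagonal) (simp add: s_def e_def of_bool_def mult_delta_left)
  have 3: "(\<lambda>i. (dagger u ** masa v s ** u) $ i $ i) = f"
    by (simp only: uv conj_diag_diagonal) (simp add: s_def f_def dagger_def)
  have "masa u f = masa v s"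
    using masa_expectations_commute [OF u v sq, of "masa u e"]
    by (simp only: masa_expectation_def 1 2 3)
  then have "dagger u ** masa u f ** v = dagger u ** masa v s ** v" by simp
  moreover have "dagger u ** masa u f ** v = diag f ** g"
    by (simp add: masa_def g_def matrix_mul_assoc hadamard_dagger [OF u])
  moreover have "dagger u ** masa v s ** v = g ** diag s"
    by (simp add: masa_def g_def matrix_mul_assoc)
      (simp add: matrix_mul_assoc [symmetric] hadamard_dagger [OF v])
  ultimately have "(diag f ** g) $ l $ k = (g ** diag s) $ l $ k" by simp
  then have "s k = f l" using nz by (simp add: diag_mult_entry mult_diag_entry)
  then show ?thesis by (simp only: s_def f_def of_real_eq_iff)
qed

lemma cmod_row_sum:
  fixes g :: "complex^'n^'n"
  assumes "g ** dagger g = mat 1"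
  shows "(\<Sum>k\<in>UNIV. (cmod (g $ j $ k))\<^sup>2) = 1"
proof -
  have "complex_of_real (\<Sum>k\<in>UNIV. (cmod (g $ j $ k))\<^sup>2) = (g ** dagger g) $ j $ j"
    unfolding of_real_sum complex_norm_square by (simp add: matrix_matrix_mult_def dagger_def)
  then have "complex_of_real (\<Sum>k\<in>UNIV. (cmod (g $ j $ k))\<^sup>2) = 1"
    by (simp only: assms) (simp add: mat_def)
  then show ?thesis by (simp only: of_real_eq_1_iff)
qed

text \<open>An entry of modulus 1 exhausts its row and its column, because both have square sum 1. So the
  positions of these entries form a permutation, and \<open>g\<close> is its matrix times the diagonal matrix of
  the phases.\<close>

lemma bg_equiv_if_monomial:
  fixes u v :: "complex^'n^'n"
  assumes u: "u ** dagger u = mat 1"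
    and g: "dagger u ** v = g" "g ** dagger g = mat 1" "dagger g ** g = mat 1"
    and one: "\<And>j. \<exists>k. cmod (g $ j $ k) = 1"
  shows "u \<sim>\<^sub>B\<^sub>G v"
proof -
  have "\<exists>q. \<forall>j. cmod (g $ j $ q j) = 1" by (rule choice) (use one in blast)
  then obtain q where q: "\<And>j. cmod (g $ j $ q j) = 1" by blast
  have rows: "(\<Sum>k\<in>UNIV. (cmod (g $ j $ k))\<^sup>2) = 1" for j
    by (rule cmod_row_sum [OF g(2)])
  have cols: "(\<Sum>j\<in>UNIV. (cmod (g $ j $ k))\<^sup>2) = 1" for k
    using cmod_row_sum [of "dagger g" k, unfolded dagger_dagger, OF g(3)] by (simp add: dagger_def)
  have z: "g $ j $ k = 0" if "k \<noteq> q j" for j k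
  proof -
    have "(\<Sum>k\<in>UNIV - {q j}. (cmod (g $ j $ k))\<^sup>2) = 0"
      using rows [of j] by (subst (asm) sum.remove [of _ "q j"]) (simp_all add: q)
    then have "\<forall>k\<in>UNIV - {q j}. (cmod (g $ j $ k))\<^sup>2 = 0"
      by (subst (asm) sum_nonneg_eq_0_iff) simp_all
    with that show ?thesis by simp
  qed
  have "inj q"
  proof
    fix i j assume eq: "q i = q j"
    show "i = j"
    proof (rule ccontr)
      assume "i \<noteq> j"
      have "(\<Sum>l\<in>{i, j}. (cmod (g $ l $ q j))\<^sup>2) \<le> (\<Sum>l\<in>UNIV. (cmod (g $ l $ q j))\<^sup>2)"
        by (rule sum_mono2) simp_all
      then show False using \<open>i \<noteq> j\<close> q [of i] q [of j] eq cols [of "q j"] by simp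
    qed
  qed
  then have bq: "bij q" by (simp add: bij_def finite_UNIV_inj_surj)
  define p where "p = inv q"
  have qp: "q (p k) = k" "p (q j) = j" for j k
    unfolding p_def
    by (rule surj_f_inv_f [OF bij_is_surj [OF bq]], rule inv_f_f [OF bij_is_inj [OF bq]])
  have pj: "i = p j \<longleftrightarrow> j = q i" for i j by (rule iffI) (simp_all add: qp)
  define P :: "complex^'n^'n" where "P = (\<chi> i j. if i = p j then 1 else 0)"
  define D where "D = diag (\<lambda>k. g $ p k $ k)"
  have PD: "P ** D = g"
  proof -
    have "(P ** D) $ i $ j = g $ i $ j" for i j
      by (cases "j = q i") (simp_all add: D_def mult_diag_entry P_def pj qp z)
    then show ?thesis by (simp add: vec_eq_iff)
  qed
  have gpk: "cmod (g $ p k $ k) = 1" for k using q [of "p k"] by (simp add: qp)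
  then have un: "g $ p k $ k * cnj (g $ p k $ k) = 1" for k
    unfolding complex_norm_square [symmetric] by simp
  have "permutation_matrix P"
    unfolding permutation_matrix_def P_def
    using bij_imp_permutes [of p UNIV] bq by (auto simp: p_def bij_imp_bij_inv)
  moreover have "diagonal_unitary D"
  proof -
    have "cnj (g $ p k $ k) * g $ p k $ k = 1" for k using un [of k] by (simp only: mult.commute)
    then have "D ** dagger D = mat 1" "dagger D ** D = mat 1"
      by (simp_all add: D_def dagger_diag diag_mult un diag_one)
    moreover have "(\<chi> i j. cnj (D $ j $ i)) = dagger D" by (simp add: dagger_def)
    moreover have "D $ i $ j = 0" if "i \<noteq> j" for i j using that by (simp add: D_def diag_def)
    ultimately show ?thesis by (simp add: diagonal_unitary_def unitary_matrix_def)
  qed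
  moreover have "v = u ** P ** D"
    unfolding matrix_mul_assoc [symmetric] PD g(1) [symmetric]
    by (simp add: matrix_mul_assoc u)
  ultimately show ?thesis unfolding bg_equiv_def by blast
qed

text \<open>If row \<open>j\<close> has no entry 1, some nonzero entry \<open>S\<^bsub>jk\<^esub>\<close> is less than its column sum, so column \<open>k\<close>
  has another nonzero entry, say in row \<open>l\<close>. By the transition rule, wherever one of the two rows is
  nonzero the other one equals the inner product \<open>c\<close> of the rows; and \<open>c\<close> is not 0. Hence both rows
  are \<open>c\<close> on a common support.\<close>

lemma doubly_stochastic_equal_rows:
  fixes S :: "'n::finite \<Rightarrow> 'n \<Rightarrow> real"
  assumes nonneg: "\<And>j k. S j k \<ge> 0"
    and rows: "\<And>j. (\<Sum>k\<in>UNIV. S j k) = 1" and cols: "\<And>k. (\<Sum>j\<in>UNIV. S j k) = 1"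
    and rule: "\<And>j l k. S l k \<noteq> 0 \<Longrightarrow> S j k = (\<Sum>m\<in>UNIV. S j m * S l m)"
    and no_one: "\<And>k. S j k \<noteq> 1"
  obtains l where "l \<noteq> j" "\<And>k. S j k = S l k"
proof -
  have "\<exists>k. S j k \<noteq> 0"
    using rows [of j] sum.neutral [of UNIV "S j"] by fastforce
  then obtain k where k: "S j k \<noteq> 0" by blast
  have "\<exists>l. l \<noteq> j \<and> S l k \<noteq> 0"
  proof (rule ccontr)
    assume "\<not> ?thesis"
    then have "(\<Sum>l\<in>UNIV - {j}. S l k) = 0" by (intro sum.neutral) auto
    then show False
      using cols [of k] no_one [of k] by (simp add: sum.remove [of UNIV j])
  qed
  then obtain l where l: "l \<noteq> j" "S l k \<noteq> 0" by blast
  define c where "c = (\<Sum>m\<in>UNIV. S j m * S l m)"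
  have c: "S l m \<noteq> 0 \<Longrightarrow> S j m = c" "S j m \<noteq> 0 \<Longrightarrow> S l m = c" for m
    using rule [of l m j] rule [of j m l] by (simp_all add: c_def mult.commute)
  have "c \<noteq> 0" using c(1) [OF l(2)] k by simp
  then have "S j m = S l m" for m using c [of m] by force
  then show ?thesis using l(1) by (intro that)
qed

section \<open>The Kadison--Kastler distance\<close>

text \<open>The distance is tested on the single vector \<open>p = p\<^sub>j + p\<^sub>l\<close>, not on the trace vector: restricted to
  it, the symmetry \<open>w\<close> becomes \<open>d = p\<^sub>j - p\<^sub>l\<close>, whose expectation onto \<open>v \<Delta> v\<^sup>*\<close> is 0. By Pythagoras
  \<open>\<parallel>(w - Y) p\<parallel>\<close> is then at least \<open>\<parallel>w p\<parallel> = \<parallel>p\<parallel>\<close>.\<close>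

lemma unitary_far_from_spin_R:
  fixes u v :: "complex^'n^'n"
  assumes u: "hadamard_unitary u" and v: "hadamard_unitary v" and jl: "j \<noteq> l"
    and eq: "\<And>k. cmod ((dagger u ** v) $ j $ k) = cmod ((dagger u ** v) $ l $ k)"
  obtains W where "W \<in> spin_R u" "norm W \<le> 1" "\<And>Y. Y \<in> spin_R v \<Longrightarrow> 1 \<le> norm (W - Y)"
proof -
  let ?g = "dagger u ** v"
  define w where "w = masa u (\<lambda>i. if i = l then - 1 else 1) \<otimes> (1 :: 'n uhf)"
  define p where "p = masa u (\<lambda>i. of_bool (i = j \<or> i = l)) \<otimes> (1 :: 'n uhf)"
  define d where "d = masa u (\<lambda>i. of_bool (i = j) - of_bool (i = l))"
  note uu = hadamard_dagger [OF u]
  have ww: "star w * w = 1"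
    by (simp add: w_def star_tensor star_one tensor_mult dagger_masa masa_mult [OF uu(2)] if_distrib
        masa_one [OF uu(1)] tensor_one cong: if_cong)
  have wp: "w * p = d \<otimes> 1"
    unfolding w_def p_def d_def tensor_mult masa_mult [OF uu(2)]
    by (rule arg_cong2 [of _ _ _ _ tensor], rule arg_cong [of _ _ "masa u"]) (use jl in auto)
  have pd: "p * star (d \<otimes> 1) = d \<otimes> 1"
    unfolding p_def d_def star_tensor dagger_masa star_one tensor_mult masa_mult [OF uu(2)]
    by (rule arg_cong2 [of _ _ _ _ tensor], rule arg_cong [of _ _ "masa u"]) (use jl in auto)
  have d: "(dagger v ** d ** v) $ k $ k = 0" for k
  proof -
    have "dagger v ** d ** v = dagger ?g ** diag (\<lambda>i. of_bool (i = j) - of_bool (i = l)) ** ?g"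
      by (simp add: d_def masa_def dagger_mult matrix_mul_assoc)
    then have "(dagger v ** d ** v) $ k $ k =
        (\<Sum>i\<in>UNIV. (of_bool (i = j) - of_bool (i = l)) * of_real ((cmod (?g $ i $ k))\<^sup>2))"
      by (simp only: conj_diag_diagonal)
    also have "\<dots> = of_real ((cmod (?g $ j $ k))\<^sup>2) - of_real ((cmod (?g $ l $ k))\<^sup>2)"
      by (simp only: left_diff_distrib sum_subtractf) (simp add: of_bool_def mult_delta_left)
    finally show ?thesis by (simp add: eq)
  qed
  have "p \<noteq> 0"
  proof
    assume "p = 0"
    then have "masa u (\<lambda>i. of_bool (i = j \<or> i = l)) \<otimes> (1 :: 'n uhf) = 0 \<otimes> 1"
      by (simp add: p_def tensor_0_left)
    then have "masa u (\<lambda>i. of_bool (i = j \<or> i = l)) = 0" by (rule tensor_one_inject)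
    then have "dagger u ** masa u (\<lambda>i. of_bool (i = j \<or> i = l)) ** u = 0"
      by simp
    then have "diag (\<lambda>i. of_bool (i = j \<or> i = l)) = (0 :: complex^'n^'n)"
      by (simp only: conj_masa [OF uu(2)])
    then have "diag (\<lambda>i. of_bool (i = j \<or> i = l)) $ j $ j = (0 :: complex^'n^'n) $ j $ j" by simp
    then show False by (simp add: diag_def)
  qed
  show ?thesis
  proof
    show "gns_rep w \<in> spin_R u" unfolding w_def by (rule masa_in_spin_R [OF u])
    show "norm (gns_rep w) \<le> 1" by (rule norm_gns_rep_isometry [OF ww])
  next
    fix Y assume Y: "Y \<in> spin_R v"
    let ?\<xi> = "embed p"
    have "cinner (Y ?\<xi>) (gns_rep w ?\<xi>) = cinner (Y 0) 0"
      using Y unfolding spin_R_eq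
    proof (rule wot_closure_coefficient_eq)
      fix S assume "S \<in> gns_rep ` spin_algebra v"
      then obtain t where S: "S = gns_rep t" and t: "t \<in> spin_algebra v" by blast
      have "cinner (S ?\<xi>) (gns_rep w ?\<xi>) = ntrace (star (d \<otimes> 1) * t * p)"
        by (simp add: S gns_rep_embed wp cinner_embed cinner_uhf_def mult.assoc)
      also have "\<dots> = ntrace (p * (star (d \<otimes> 1) * t))" by (rule ntrace_commute)
      also have "\<dots> = 0"
        using spin_algebra_orthogonal [OF v d t] by (simp only: mult.assoc [symmetric] pd)
      finally show "cinner (S ?\<xi>) (gns_rep w ?\<xi>) = cinner (S 0) 0"
        by (simp add: blinfun.zero_right cinner_zero_left)
    qed
    then have "cinner (Y ?\<xi>) (gns_rep w ?\<xi>) = 0"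
      by (simp add: blinfun.zero_right cinner_zero_left)
    then have "inner (gns_rep w ?\<xi>) (Y ?\<xi>) = 0"
      by (subst inner_commute) (simp flip: Re_cinner)
    then have "(norm ((gns_rep w - Y) ?\<xi>))\<^sup>2 = (norm (gns_rep w ?\<xi>))\<^sup>2 + (norm (Y ?\<xi>))\<^sup>2"
      by (simp add: blinfun.diff_left power2_norm_eq_inner inner_diff_left inner_diff_right inner_commute)
    then have "(norm (gns_rep w ?\<xi>))\<^sup>2 \<le> (norm ((gns_rep w - Y) ?\<xi>))\<^sup>2" by simp
    then have "norm (gns_rep w ?\<xi>) \<le> norm ((gns_rep w - Y) ?\<xi>)"
      by (simp add: power2_le_iff_abs_le)
    then have "norm ?\<xi> \<le> norm ((gns_rep w - Y) ?\<xi>)"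
      by (simp add: gns_rep_embed norm_embed norm_isometry [OF ww])
    also have "\<dots> \<le> norm (gns_rep w - Y) * norm ?\<xi>" by (rule norm_blinfun)
    finally show "1 \<le> norm (gns_rep w - Y)"
      using \<open>p \<noteq> 0\<close> by (simp add: norm_embed)
  qed
qed

lemma zero_in_spin_R:
  fixes v :: "complex^'n^'n"
  assumes "hadamard_unitary v"
  shows "0 \<in> spin_R v"
proof -
  have "masa v (\<lambda>_. 0) = 0"
    by (simp add: masa_def diag_def flip: zero_vec_def)
  then have "gns_rep (masa v (\<lambda>_. 0) \<otimes> 1) = 0"
    by (intro gns_op_eqI) (simp add: tensor_0_left gns_rep_embed embed_0)
  then show ?thesis using masa_in_spin_R [OF assms, of "\<lambda>_. 0"] by simp
qed

text \<open>The upper bound holds because 0 lies in both unit balls; it also bounds the suprema, which are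
  taken in the reals.\<close>

lemma kk_distance_eq_1:
  assumes P: "0 \<in> P" and Q: "0 \<in> Q" and W: "W \<in> P" "norm W \<le> 1"
    and far: "\<And>Y. Y \<in> Q \<Longrightarrow> 1 \<le> norm (W - Y)"
  shows "kk_distance P Q = 1"
proof -
  define A where "A = {T \<in> P. norm T \<le> 1}"
  define B where "B = {T \<in> Q. norm T \<le> 1}"
  have 0: "0 \<in> A" "0 \<in> B" using P Q by (simp_all add: A_def B_def)
  have le: "infdist x C \<le> 1" if "0 \<in> C" "norm x \<le> 1" for x :: "'a \<Rightarrow>\<^sub>L 'a" and C
    using infdist_le [OF that(1), of x] that(2) by simp
  have "(SUP x\<in>A. infdist x B) \<le> 1"
    by (rule cSUP_least) (use 0 in \<open>auto simp: A_def intro: le\<close>)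
  moreover have "(SUP x\<in>B. infdist x A) \<le> 1"
    by (rule cSUP_least) (use 0 in \<open>auto simp: B_def intro: le\<close>)
  moreover have "1 \<le> infdist W B"
    unfolding infdist_def using 0 far by (auto simp: B_def dist_norm intro!: cINF_greatest)
  moreover have "infdist W B \<le> (SUP x\<in>A. infdist x B)"
    by (rule cSUP_upper) (use W 0 in \<open>auto simp: A_def intro!: bdd_aboveI [of _ 1] le\<close>)
  ultimately show ?thesis
    by (simp add: kk_distance_def hausdorff_distance_def A_def B_def)
qed

text \<open>Inequivalence provides a row of \<open>g\<close> without an entry of modulus 1, hence two rows of equal
  moduli.\<close>

lemma commuting_square_kk_distance:
  fixes u v :: "complex^'n^'n"
  assumes u: "hadamard_unitary u" and v: "hadamard_unitary v" and inequiv: "\<not> u \<sim>\<^sub>B\<^sub>G v"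
    and sq: "commuting_square vector_trace hyperfinite_R (spin_R u) (spin_R v) N"
  shows "kk_distance (spin_R u) (spin_R v) = 1"
proof -
  define g where "g = dagger u ** v"
  have "g ** dagger g = dagger u ** (v ** dagger v) ** u" "dagger g ** g = dagger v ** (u ** dagger u) ** v"
    by (simp_all add: g_def dagger_mult matrix_mul_assoc)
  then have gg: "g ** dagger g = mat 1" "dagger g ** g = mat 1"
    by (simp_all add: hadamard_dagger [OF u] hadamard_dagger [OF v])
  obtain j where j: "\<And>k. cmod (g $ j $ k) \<noteq> 1"
    using bg_equiv_if_monomial [OF hadamard_dagger(1) [OF u] g_def [symmetric] gg] inequiv by blast
  obtain l where l: "l \<noteq> j" "\<And>k. (cmod (g $ j $ k))\<^sup>2 = (cmod (g $ l $ k))\<^sup>2"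
  proof (rule doubly_stochastic_equal_rows [of "\<lambda>j k. (cmod (g $ j $ k))\<^sup>2" j])
    show "(\<Sum>k\<in>UNIV. (cmod (g $ j $ k))\<^sup>2) = 1" for j by (rule cmod_row_sum [OF gg(1)])
    show "(\<Sum>j\<in>UNIV. (cmod (g $ j $ k))\<^sup>2) = 1" for k
      using cmod_row_sum [of "dagger g" k, unfolded dagger_dagger, OF gg(2)] by (simp add: dagger_def)
    show "(cmod (g $ j $ k))\<^sup>2 = (\<Sum>m\<in>UNIV. (cmod (g $ j $ m))\<^sup>2 * (cmod (g $ l $ m))\<^sup>2)"
      if "(cmod (g $ l $ k))\<^sup>2 \<noteq> 0" for j l k
      using commuting_square_transition [OF u v sq, of l k j] that by (simp add: g_def)
    show "(cmod (g $ j $ k))\<^sup>2 \<noteq> 1" for k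
      using j [of k] by (simp add: power2_eq_1_iff) (metis norm_ge_zero neg_0_le_iff_le not_one_le_zero)
  qed auto
  then have "cmod ((dagger u ** v) $ j $ k) = cmod ((dagger u ** v) $ l $ k)" for k
    by (simp add: g_def power2_eq_iff_nonneg)
  then obtain W where "W \<in> spin_R u" "norm W \<le> 1" "\<And>Y. Y \<in> spin_R v \<Longrightarrow> 1 \<le> norm (W - Y)"
    using unitary_far_from_spin_R [OF u v l(1) [symmetric]] by blast
  then show ?thesis
    by (intro kk_distance_eq_1 [of _ _ W] zero_in_spin_R u v)
qed

theorem corollary4p6:
  fixes u v :: "complex^'n^'n"
  assumes "CARD('n) \<ge> 2"
    and "hadamard_unitary u" and "hadamard_unitary v"
    and "\<not> u \<sim>\<^sub>B\<^sub>G v"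
    and "kk_distance (spin_R u) (spin_R v) \<noteq> 1"
  shows "\<not> finite_index_subfactor_R (spin_R u \<inter> spin_R v) \<or>
    \<not> commuting_square vector_trace hyperfinite_R (spin_R u) (spin_R v) (spin_R u \<inter> spin_R v)"
  using commuting_square_kk_distance assms by blast

end
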